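(* Let $d\ge 1$ be an integer, $\sigma\ge 1$ a real number, $X=Y=Z=\mathbb{R}^d$ and $c(x,y)=|x-y|^\sigma$. If $\nu=\mu=f(x)\,dx$ is a Borel probability measure on $\mathbb{R}^d$ with density $f$ with respect to Lebesgue measure, then $$\lim_{m\to\infty}m^{\sigma/d}\,\phi^m(\mu,\mu)=C_{d,\sigma}\left(\int_{\mathbb{R}^d}f^{d/(d+\sigma)}\,dx\right)^{(d+\sigma)/d},$$ where $C_{d,\sigma}$ is some universal constant (depending only on $d$ and $\sigma$).
   Context: Here $|\cdot|$ is the Euclidean norm on $\mathbb{R}^d$, and $c^{(1)}(x,z)=2^{\sigma-1}|x-z|^\sigma$, $c^{(2)}(z,y)=2^{\sigma-1}|z-y|^\sigma$, so that $c(x,y)=\inf_{z\in\mathbb{R}^d}\left[c^{(1)}(x,z)+c^{(2)}(z,y)\right]$. For a finite set $Z_m\subset\mathbb{R}^d$ of $m$ points, $c^{Z_m}(x,y):=\min_{z\in Z_m}\left[c^{(1)}(x,z)+c^{(2)}(z,y)\right]$. For Borel probability measures $\mu,\nu$ on $\mathbb{R}^d$, $c(\mu,\nu)$ and $c^{Z_m}(\mu,\nu)$ denote the minima over all couplings $\pi$ of $\mu$ and $\nu$ (Borel probability measures on $\mathbb{R}^d\times\mathbb{R}^d$ with marginals $\mu$ and $\nu$) of $\int c\,d\pi$ and $\int c^{Z_m}\,d\pi$ respectively. Finally $$\phi^m(\mu,\nu):=\inf_{Z_m\subset\mathbb{R}^d,\ \#Z_m=m}c^{Z_m}(\mu,\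nu)-c(\mu,\nu).$$
   Formalization: The claim fails for some heavy-tailed densities, so it is proved under the added assumption that, whenever the integral of f^{d/(d+σ)} is finite, the integral of |x|^{σ+δ} f is finite for some δ>0; when the former integral is infinite, nothing is added. *)

theory Defs
  imports "HOL-Probability.Probability"
begin

definition couplings ::
  "'a::topological_space measure \<Rightarrow> 'b::topological_space measure \<Rightarrow> ('a \<times> 'b) measure set"
  where "couplings \<mu> \<nu> =
    {\<pi>. prob_space \<pi> \<and> sets \<pi> = sets borel \<and>
         distr \<pi> borel fst = \<mu> \<and> distr \<pi> borel snd = \<nu>}"

(* Values lie in [0,\<infinity>].  For the lower semicontinuous costs used here the infimum is a minimum. *)
definition transport_cost ::
  "('a::topological_space \<Rightarrow> 'b::topological_space \<Rightarrow> real) \<Rightarrow> 'a measure \<Rightarrow> 'b measure \<Rightarrow> ennreal"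
  where "transport_cost c \<mu> \<nu> =
    (INF \<pi>\<in>couplings \<mu> \<nu>. \<integral>\<^sup>+ p. ennreal (c (fst p) (snd p)) \<partial>\<pi>)"

definition cost :: "real \<Rightarrow> 'a::real_normed_vector \<Rightarrow> 'a \<Rightarrow> real"
  where "cost \<sigma> x y = norm (x - y) powr \<sigma>"

definition cost1 :: "real \<Rightarrow> 'a::real_normed_vector \<Rightarrow> 'a \<Rightarrow> real"
  where "cost1 \<sigma> x z = 2 powr (\<sigma> - 1) * norm (x - z) powr \<sigma>"

definition cost2 :: "real \<Rightarrow> 'a::real_normed_vector \<Rightarrow> 'a \<Rightarrow> real"
  where "cost2 \<sigma> z y = 2 powr (\<sigma> - 1) * norm (z - y) powr \<sigma>"

(* Only meaningful for finite nonempty Z. *)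
definition cost_via :: "real \<Rightarrow> 'a::real_normed_vector set \<Rightarrow> 'a \<Rightarrow> 'a \<Rightarrow> real"
  where "cost_via \<sigma> Z x y = Min ((\<lambda>z. cost1 \<sigma> x z + cost2 \<sigma> z y) ` Z)"

(* Since cost \<sigma> \<le> cost_via \<sigma> Z for \<sigma> \<ge> 1, truncation in the ennreal subtraction plays no role. *)
definition phi ::
  "real \<Rightarrow> nat \<Rightarrow> 'a::real_normed_vector measure \<Rightarrow> 'a measure \<Rightarrow> ennreal"
  where "phi \<sigma> m \<mu> \<nu> =
    (INF Z\<in>{Z. finite Z \<and> card Z = m}. transport_cost (cost_via \<sigma> Z) \<mu> \<nu>)
      - transport_cost (cost \<sigma>) \<mu> \<nu>"

(* Power of an element of [0,\<infinity>], for exponents p > 0. *)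
definition ennreal_powr :: "ennreal \<Rightarrow> real \<Rightarrow> ennreal"
  where "ennreal_powr x p = (if x = \<infinity> then \<infinity> else ennreal (enn2real x powr p))"

(* The moment hypothesis of Zador's theorem.  It is not redundant: for d = \<sigma> = 1 the density
   f = (\<Sum>k\<ge>1. 2^(-k) * indicator {4^k..4^k + 1}) has finite integral of f powr (1/2), whereas its
   first moment, and hence phi, is infinite for every m. *)
definition finite_higher_moment :: "real \<Rightarrow> ('a::euclidean_space \<Rightarrow> real) \<Rightarrow> bool"
  where "finite_higher_moment \<sigma> f \<longleftrightarrow>
    (\<exists>\<delta>>0. (\<integral>\<^sup>+ x. ennreal (norm x powr (\<sigma> + \<delta>) * f x) \<partial>lborel) < \<infinity>)"

end

theory Submission
  imports Defs "HOL-Real_Asymp.Real_Asymp"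
begin

text \<open>
  For every coupling of \<open>\<mu>\<close> with itself the cost via \<open>Z\<close> is at least
  \<open>2 powr (\<sigma> - 1) * (dist(x, Z) powr \<sigma> + dist(y, Z) powr \<sigma>)\<close>, with equality on the diagonal. Hence
  \<open>phi \<sigma> m \<mu> \<mu>\<close> is \<open>2 powr \<sigma>\<close> times the optimal quantization error of order \<open>\<sigma>\<close>, and the claim is
  Zador's theorem. Put \<open>\<rho> = \<sigma> / d\<close>. Quantizing the summands separately and distributing the points
  proportionally to \<open>N\<close> and \<open>M\<close> shows that asymptotic upper bounds of the form
  \<open>Q * N powr (1 + \<rho>)\<close> are additive in \<open>N\<close>; self-similarity of the unit cube gives the constant \<open>Q\<close>,
  and coverings by cubes give \<open>N = \<bar>A\<bar>\<close> for a bounded set \<open>A\<close>. Applied to the complement of \<open>A\<close> in a cube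
  this upper bound also yields the matching lower bound for \<open>A\<close>. A convexity argument extends the
  lower bound to densities that are constant on finitely many disjoint compact sets, and every \<open>f\<close>
  dominates such densities. For the upper bound, \<open>f\<close> minus a simple function below it is
  controlled by a net whose spacing grows with the norm; this is where the moment enters.
\<close>

subsection \<open>Optimal quantization error\<close>

text \<open>The exponent 1 + \<rho> makes the calculus additive: the minimum over \<theta> of q
  N^(1+\<rho>) \<theta>^(-\<rho>) + q M^(1+\<rho>) (1-\<theta>)^(-\<rho>) is q (N+M)^(1+\<rho>). A
  constant density y on A has error constant Q y |A|^(1+\<rho>), that is N = y^(1/(1+\<rho>)) |A|;
  hence the integral of f^(1/(1+\<rho>)) in the limit, and 1/(1+\<rho>) = d/(d+\<sigma>). The
  obstacle is the lower bound. Merging point sets gives subadditivity only, because one point may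
  serve several pieces. Since Q is defined as an infimum, cubes satisfy the lower bound for every m
  by definition, and subadditivity itself carries it over from a cube to a subset. Several level
  sets are treated together by shrinking them to compact sets, whose positive distance prevents the
  sharing of points. For the upper bound, a remainder of small mass need not be cheap if it lies far
  out. It has to be small in a weighted L1 norm.\<close>

lemma borel_measurable_infdist [measurable (raw)]:
  fixes Z :: "'a::metric_space set"
  assumes "f \<in> borel_measurable M"
  shows "(\<lambda>x. infdist (f x) Z) \<in> borel_measurable M"
  by (rule measurable_compose[OF assms])
    (intro borel_measurable_continuous_onI continuous_intros)

lemma nn_integral_lborel_affine:
  fixes f :: "'a::euclidean_space \<Rightarrow> ennreal"
  assumes [measurable]: "f \<in> borel_measurable borel" and "c \<noteq> 0"
  shows "(\<integral>\<^sup>+x. f x \<partial>lborel) = ennreal (\<bar>c\<bar> ^ DIM('a)) * (\<integral>\<^sup>+x. f (t + c *\<^sub>R x) \<partial>lborel)"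
  by (subst lborel_affine[OF \<open>c \<noteq> 0\<close>, of t])
    (simp add: nn_integral_density nn_integral_distr nn_integral_cmult)

lemma INF_add_const_ennreal:
  fixes f :: "'b \<Rightarrow> ennreal"
  assumes "I \<noteq> {}"
  shows "(INF i\<in>I. f i + c) = (INF i\<in>I. f i) + c"
  using continuous_at_Inf_mono[of "\<lambda>x. x + c" "f ` I"] assms
  using continuous_add[of "at_right (Inf (f ` I))", of "\<lambda>x. x" "\<lambda>x. c"]
  by (auto simp: mono_def image_comp)

text \<open>The \<open>itself\<close> parameter pins down the space: \<open>rate\<close> and
  \<open>quantization_const\<close> are reals that depend on its dimension, although their own types
  do not mention it.\<close>

locale quantization =
  fixes r :: real and T :: "'a::euclidean_space itself"
  assumes r_pos: "0 < r"
begin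

definition distortion :: "'a set \<Rightarrow> ('a \<Rightarrow> ennreal) \<Rightarrow> ennreal"
  where "distortion Z g = (\<integral>\<^sup>+x. ennreal (infdist x Z powr r) * g x \<partial>lborel)"

text \<open>The empty set is excluded because \<open>infdist x {} = 0\<close>.\<close>

definition qerr :: "nat \<Rightarrow> ('a \<Rightarrow> ennreal) \<Rightarrow> ennreal"
  where "qerr m g = (INF Z\<in>{Z. finite Z \<and> Z \<noteq> {} \<and> card Z \<le> m}. distortion Z g)"

definition rate :: real
  where "rate = r / real DIM('a)"

lemma rate_pos: "0 < rate"
  using r_pos by (simp add: rate_def)

lemma qerr_le: "finite Z \<Longrightarrow> Z \<noteq> {} \<Longrightarrow> card Z \<le> m \<Longrightarrow> qerr m g \<le> distortion Z g"
  unfolding qerr_def by (rule INF_lower) auto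

lemma qerr_greatest:
  "(\<And>Z. finite Z \<Longrightarrow> Z \<noteq> {} \<Longrightarrow> card Z \<le> m \<Longrightarrow> b \<le> distortion Z g) \<Longrightarrow> b \<le> qerr m g"
  unfolding qerr_def by (rule INF_greatest) auto

lemma qerr_0 [simp]: "qerr 0 g = \<top>"
  unfolding qerr_def by (auto intro!: INF_eqI)

lemma qerr_mono: "(\<And>x. g x \<le> h x) \<Longrightarrow> m \<le> n \<Longrightarrow> qerr n g \<le> qerr m h"
  unfolding qerr_def distortion_def
  by (intro INF_superset_mono nn_integral_mono mult_left_mono) auto

lemma distortion_mono:
  assumes "Z \<subseteq> W" "Z \<noteq> {}" "\<And>x. g x \<le> h x"
  shows "distortion W g \<le> distortion Z h"
  unfolding distortion_def
  using assms r_pos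
  by (intro nn_integral_mono mult_mono ennreal_leI powr_mono2 infdist_mono infdist_nonneg) auto

lemma distortion_add:
  assumes "g \<in> borel_measurable borel" "h \<in> borel_measurable borel"
  shows "distortion Z (\<lambda>x. g x + h x) = distortion Z g + distortion Z h"
proof -
  have [measurable]: "g \<in> borel_measurable lborel" "h \<in> borel_measurable lborel"
    using assms by auto
  show ?thesis
    unfolding distortion_def distrib_left by (rule nn_integral_add) measurable
qed

text \<open>Merge the two point sets: each summand is then served at least as well as by its own
  set.\<close>

lemma qerr_subadditive:
  assumes "g \<in> borel_measurable borel" "h \<in> borel_measurable borel"
  shows "qerr (m + n) (\<lambda>x. g x + h x) \<le> qerr m g + qerr n h"
\<comment> \<open>If m or n is 0, the right-hand side is \<top> by \<open>qerr_0\<close>. Otherwise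
  both families of point sets are nonempty, as \<open>INF_add_const_ennreal\<close>
  requires.\<close>
proof (cases "m = 0 \<or> n = 0")
  case False
  let ?A = "\<lambda>m. {Z::'a set. finite Z \<and> Z \<noteq> {} \<and> card Z \<le> m}"
  have ne: "?A k \<noteq> {}" if "k \<noteq> 0" for k
    using that by (auto intro!: exI[of _ "{0}"])
  have *: "qerr (m + n) (\<lambda>x. g x + h x) \<le> distortion Z g + distortion W h"
    if "Z \<in> ?A m" "W \<in> ?A n" for Z W
  proof -
    have "card (Z \<union> W) \<le> m + n"
      using card_Un_le[of Z W] that by auto
    then have "qerr (m + n) (\<lambda>x. g x + h x) \<le> distortion (Z \<union> W) (\<lambda>x. g x + h x)"
      using that by (intro qerr_le) auto
    also have "\<dots> = distortion (Z \<union> W) g + distortion (Z \<union> W) h"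
      by (rule distortion_add[OF assms])
    also have "\<dots> \<le> distortion Z g + distortion W h"
      using that by (intro add_mono distortion_mono) auto
    finally show ?thesis .
  qed
  have "qerr (m + n) (\<lambda>x. g x + h x) \<le> distortion Z g + qerr n h" if "Z \<in> ?A m" for Z
    unfolding qerr_def[of n] add.commute[of "distortion Z g"]
    by (subst INF_add_const_ennreal[symmetric])
      (use *[OF that] ne[of n] False in \<open>auto intro!: INF_greatest simp: add.commute[of _ "distortion Z g"]\<close>)
  then show ?thesis
    unfolding qerr_def[of m]
    by (subst INF_add_const_ennreal[symmetric]) (use ne False in \<open>auto intro!: INF_greatest\<close>)
qed auto

lemma qerr_sum_le:
  assumes "finite I" "I \<noteq> {}" "\<And>i. i \<in> I \<Longrightarrow> g i \<in> borel_measurable borel"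
  shows "qerr (\<Sum>i\<in>I. m i) (\<lambda>x. \<Sum>i\<in>I. g i x) \<le> (\<Sum>i\<in>I. qerr (m i) (g i))"
  using assms
proof (induction rule: finite_ne_induct)
  case (insert i I)
  have "qerr (m i + (\<Sum>i\<in>I. m i)) (\<lambda>x. g i x + (\<Sum>i\<in>I. g i x)) \<le> qerr (m i) (g i) + qerr (\<Sum>i\<in>I. m i) (\<lambda>x. \<Sum>i\<in>I. g i x)"
    using insert by (intro qerr_subadditive borel_measurable_sum) auto
  also have "\<dots> \<le> qerr (m i) (g i) + (\<Sum>i\<in>I. qerr (m i) (g i))"
    using insert by (intro add_mono) auto
  finally show ?case using insert by simp
qed simp

section \<open>Homogeneity and affine scaling\<close>

lemma distortion_cmult:
  assumes "g \<in> borel_measurable borel"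
  shows "distortion Z (\<lambda>x. ennreal y * g x) = ennreal y * distortion Z g"
proof -
  have [measurable]: "g \<in> borel_measurable lborel" using assms by simp
  show ?thesis
    unfolding distortion_def by (subst nn_integral_cmult[symmetric]) (auto simp: ac_simps)
qed

lemma qerr_cmult:
  assumes "g \<in> borel_measurable borel" and pos: "0 < a"
  shows "qerr m (\<lambda>x. ennreal a * g x) = ennreal a * qerr m g"
proof -
  note * = distortion_cmult[OF assms(1)]
  have 1: "qerr m (\<lambda>x. ennreal a * g x) \<le> ennreal a * distortion Z g"
    if "finite Z" "Z \<noteq> {}" "card Z \<le> m" for Z
    using qerr_le[OF that, of "\<lambda>x. ennreal a * g x"] by (simp add: * )
  have "ennreal a * qerr m g \<le> qerr m (\<lambda>x. ennreal a * g x)"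
    by (rule qerr_greatest) (auto simp: * intro!: mult_left_mono qerr_le)
  moreover have "ennreal (1/a) * qerr m (\<lambda>x. ennreal a * g x) \<le> qerr m g"
  proof (rule qerr_greatest)
    fix Z :: "'a set" assume "finite Z" "Z \<noteq> {}" "card Z \<le> m"
    from mult_left_mono[OF 1[OF this], of "ennreal (1/a)"] pos
    show "ennreal (1/a) * qerr m (\<lambda>x. ennreal a * g x) \<le> distortion Z g"
      by (simp add: mult.assoc[symmetric] ennreal_mult[symmetric])
  qed
  then have "ennreal a * (ennreal (1/a) * qerr m (\<lambda>x. ennreal a * g x)) \<le> ennreal a * qerr m g"
    by (rule mult_left_mono) simp
  then have "qerr m (\<lambda>x. ennreal a * g x) \<le> ennreal a * qerr m g"
    using pos by (simp add: mult.assoc[symmetric] ennreal_mult[symmetric])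
  ultimately show ?thesis by (rule antisym[rotated])
qed

lemma infdist_affine:
  fixes x t :: 'a
  assumes "0 < h"
  shows "infdist (t + h *\<^sub>R x) ((\<lambda>z. t + h *\<^sub>R z) ` Z) = h * infdist x Z"
proof (cases "Z = {}")
  case False
  have "(INF a\<in>Z. dist (t + h *\<^sub>R x) (t + h *\<^sub>R a)) = (INF a\<in>Z. h * dist x a)"
    using assms by (intro INF_cong refl) (simp add: dist_norm flip: scaleR_diff_right)
  also have "\<dots> = h * (INF a\<in>Z. dist x a)"
  proof (rule continuous_at_Inf_mono[THEN trans, symmetric, where f="\<lambda>y. h * y" and S="dist x ` Z", unfolded image_image])
  qed (use assms False in \<open>auto intro!: monoI mult_left_mono bdd_belowI[of _ 0] continuous_intros\<close>)
  finally show ?thesis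
    using False by (simp add: infdist_def image_image)
qed (simp add: infdist_def)

text \<open>The Jacobian contributes h^d and the distances contribute h^r.\<close>

lemma distortion_affine:
  assumes [measurable]: "g \<in> borel_measurable borel" and h: "0 < h"
  shows "distortion ((\<lambda>z. t + h *\<^sub>R z) ` Z) g
    = ennreal (h powr (real DIM('a) + r)) * distortion Z (\<lambda>x. g (t + h *\<^sub>R x))"
proof -
  have "distortion ((\<lambda>z. t + h *\<^sub>R z) ` Z) g
     = ennreal (h ^ DIM('a)) * (\<integral>\<^sup>+x. ennreal ((h * infdist x Z) powr r) * g (t + h *\<^sub>R x) \<partial>lborel)"
    unfolding distortion_def
    by (subst nn_integral_lborel_affine[where c=h and t=t]) (use h in \<open>auto simp: infdist_affine\<close>)
  also have "(\<lambda>x. ennreal ((h * infdist x Z) powr r) * g (t + h *\<^sub>R x))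
     = (\<lambda>x. ennreal (h powr r) * (ennreal (infdist x Z powr r) * g (t + h *\<^sub>R x)))"
    using h by (simp add: powr_mult infdist_nonneg ennreal_mult mult.assoc)
  also have "(\<integral>\<^sup>+x. ennreal (h powr r) * (ennreal (infdist x Z powr r) * g (t + h *\<^sub>R x)) \<partial>lborel)
     = ennreal (h powr r) * distortion Z (\<lambda>x. g (t + h *\<^sub>R x))"
    unfolding distortion_def by (rule nn_integral_cmult) measurable
  finally show ?thesis
    using h by (simp add: powr_add powr_realpow ennreal_mult mult.assoc)
qed

lemma qerr_affine_le:
  assumes [measurable]: "g \<in> borel_measurable borel" and h: "0 < h"
  shows "ennreal (h powr (real DIM('a) + r)) * qerr m (\<lambda>x. g (t + h *\<^sub>R x)) \<le> qerr m g"
proof (rule qerr_greatest)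
  fix Z :: "'a set" assume Z: "finite Z" "Z \<noteq> {}" "card Z \<le> m"
  let ?W = "(\<lambda>z. - ((1/h) *\<^sub>R t) + (1/h) *\<^sub>R z) ` Z"
  have "(\<lambda>z. t + h *\<^sub>R z) ` ?W = Z"
    using h by (simp add: image_image scaleR_add_right scaleR_diff_right)
  then have "distortion Z g = ennreal (h powr (real DIM('a) + r)) * distortion ?W (\<lambda>x. g (t + h *\<^sub>R x))"
    using distortion_affine[OF assms, of t ?W] by simp
  moreover have "qerr m (\<lambda>x. g (t + h *\<^sub>R x)) \<le> distortion ?W (\<lambda>x. g (t + h *\<^sub>R x))"
    using Z card_image_le[OF Z(1)] by (intro qerr_le) (auto intro: order_trans)
  ultimately show "ennreal (h powr (real DIM('a) + r)) * qerr m (\<lambda>x. g (t + h *\<^sub>R x)) \<le> distortion Z g"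
    by (auto intro: mult_left_mono)
qed

lemma qerr_affine:
  assumes [measurable]: "g \<in> borel_measurable borel" and h: "0 < h"
  shows "qerr m g = ennreal (h powr (real DIM('a) + r)) * qerr m (\<lambda>x. g (t + h *\<^sub>R x))"
proof (rule antisym)
  let ?d = "real DIM('a) + r"
  \<comment> \<open>The inverse map is again a translation after a dilation, so the inequality
    already proved applies to it.\<close>
  have "ennreal ((1/h) powr ?d) * qerr m g \<le> qerr m (\<lambda>x. g (t + h *\<^sub>R x))"
    using qerr_affine_le[of "\<lambda>x. g (t + h *\<^sub>R x)" "1/h" m "- ((1/h) *\<^sub>R t)"] h
    by (simp add: scaleR_add_right scaleR_diff_right)
  then have "ennreal (h powr ?d) * (ennreal ((1/h) powr ?d) * qerr m g)
    \<le> ennreal (h powr ?d) * qerr m (\<lambda>x. g (t + h *\<^sub>R x))"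
    by (rule mult_left_mono) simp
  then show "qerr m g \<le> ennreal (h powr ?d) * qerr m (\<lambda>x. g (t + h *\<^sub>R x))"
    using h by (simp add: mult.assoc[symmetric] ennreal_mult[symmetric] powr_mult[symmetric])
qed (rule qerr_affine_le[OF assms])

end

subsection \<open>Asymptotic bounds\<close>

context quantization
begin

text \<open>For c \<ge> 0 this says that the limsup of m^rate times the error is at most c;
  \<open>lower\<close> is the same for the liminf. The slack c' is built in so that bounds can be
  proved up to an arbitrarily small loss. As \<open>ennreal\<close> cuts off negative numbers,
  \<open>lower g c\<close> is trivial for c \<le> 0.\<close>

definition upper :: "('a \<Rightarrow> ennreal) \<Rightarrow> real \<Rightarrow> bool"
  where "upper g c \<longleftrightarrow>
    (\<forall>c'>c. \<forall>\<^sub>F m in sequentially. qerr m g \<le> ennreal (c' * real m powr - rate))"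

definition lower :: "('a \<Rightarrow> ennreal) \<Rightarrow> real \<Rightarrow> bool"
  where "lower g c \<longleftrightarrow>
    (\<forall>c'<c. \<forall>\<^sub>F m in sequentially. ennreal (c' * real m powr - rate) \<le> qerr m g)"

lemma upper_mono:
  assumes "upper h b" "\<And>x. g x \<le> h x" "b \<le> c"
  shows "upper g c"
  unfolding upper_def
proof (intro allI impI)
  fix c' assume "c < c'"
  with assms have "\<forall>\<^sub>F m in sequentially. qerr m h \<le> ennreal (c' * real m powr - rate)"
    by (simp add: upper_def)
  then show "\<forall>\<^sub>F m in sequentially. qerr m g \<le> ennreal (c' * real m powr - rate)"
    by eventually_elim (rule order_trans[OF qerr_mono[OF assms(2) order_refl]])
qed

lemma lower_mono:
  assumes "lower h b" "\<And>x. h x \<le> g x" "c \<le> b"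
  shows "lower g c"
  unfolding lower_def
proof (intro allI impI)
  fix c' assume "c' < c"
  with assms have "\<forall>\<^sub>F m in sequentially. ennreal (c' * real m powr - rate) \<le> qerr m h"
    by (simp add: lower_def)
  then show "\<forall>\<^sub>F m in sequentially. ennreal (c' * real m powr - rate) \<le> qerr m g"
    by eventually_elim (rule order_trans[OF _ qerr_mono[OF assms(2) order_refl]])
qed

lemma upper_limit:
  assumes "\<And>c'. c < c' \<Longrightarrow> upper g c'"
  shows "upper g c"
  unfolding upper_def
proof (intro allI impI)
  fix c' assume "c < c'"
  then obtain b where "c < b" "b < c'" using dense by blast
  with assms[of b] show "\<forall>\<^sub>F m in sequentially. qerr m g \<le> ennreal (c' * real m powr - rate)"
    by (simp add: upper_def)
qed

lemma lower_limit:
  assumes "\<And>c'. c' < c \<Longrightarrow> lower g c'"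
  shows "lower g c"
  unfolding lower_def
proof (intro allI impI)
  fix c' assume "c' < c"
  then obtain b where "c' < b" "b < c" using dense by blast
  with assms[of b] show "\<forall>\<^sub>F m in sequentially. ennreal (c' * real m powr - rate) \<le> qerr m g"
    by (simp add: lower_def)
qed

text \<open>Continuity in N. It provides the room \<epsilon> that makes masses positive in
  \<open>upper_add\<close> and absorbs remainders later.\<close>

lemma upper_powr_limit:
  assumes "\<And>\<epsilon>. 0 < \<epsilon> \<Longrightarrow> upper g (q * (N + \<epsilon>) powr (1 + rate))" "0 \<le> N"
  shows "upper g (q * N powr (1 + rate))"
proof (rule upper_limit)
  fix c assume c: "q * N powr (1 + rate) < c"
  have "((\<lambda>\<epsilon>. q * (N + \<epsilon>) powr (1 + rate)) \<longlongrightarrow> q * (N + 0) powr (1 + rate)) (at_right 0)"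
    using assms(2) rate_pos
    by (intro tendsto_intros tendsto_powr2) (auto simp: eventually_at_right_less intro!: eventually_mono[OF eventually_at_right_less])
  then have "\<forall>\<^sub>F \<epsilon> in at_right 0. q * (N + \<epsilon>) powr (1 + rate) < c"
    using c by (intro order_tendstoD) auto
  then have "\<forall>\<^sub>F \<epsilon> in at_right 0. 0 < \<epsilon> \<and> q * (N + \<epsilon>) powr (1 + rate) < c"
    using eventually_at_right_less[of "0::real"] by eventually_elim simp
  then obtain \<epsilon> where "0 < \<epsilon>" "q * (N + \<epsilon>) powr (1 + rate) < c"
    using eventually_happens'[of "at_right (0::real)"] by (auto simp: trivial_limit_at_right_real)
  with assms(1)[of \<epsilon>] show "upper g c"
    by (auto intro: upper_mono)
qed

section \<open>Splitting the points between two summands\<close>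

lemma fraction_powr_tendsto:
  assumes "(\<lambda>m. real (k m) / real m) \<longlonglongrightarrow> \<theta>" "0 < \<theta>"
  shows "(\<lambda>m. b * (real (k m) / real m) powr - rate) \<longlonglongrightarrow> b * \<theta> powr - rate"
  using assms by (intro tendsto_intros) auto

lemma powr_fraction:
  assumes "0 < m"
  shows "real k powr - rate = (real k / real m) powr - rate * real m powr - rate"
  using assms by (subst powr_mult[symmetric]) auto

text \<open>Working with k m ~ \<theta> m points instead of m costs the factor \<theta>^(-rate); the
  strict gap below c absorbs the deviation of k m / m from \<theta>. The ratio \<theta> may exceed
  1, as can happen in \<open>lower_bounded_set\<close>.\<close>

lemma upper_fraction:
  assumes "upper g a" "0 \<le> a" "0 < \<theta>" "a * \<theta> powr - rate < c"
    and k: "filterlim k at_top sequentially" "(\<lambda>m. real (k m) / real m) \<longlonglongrightarrow> \<theta>"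
  shows "\<forall>\<^sub>F m in sequentially. qerr (k m) g \<le> ennreal (c * real m powr - rate)"
proof -
  have "a < c * \<theta> powr rate"
    using assms(3,4) by (simp add: powr_minus field_simps)
  then obtain b where b: "a < b" "b < c * \<theta> powr rate" using dense by blast
  have "b * \<theta> powr - rate < c"
    using b assms(3) by (simp add: powr_minus field_simps)
  then have "\<forall>\<^sub>F m in sequentially. b * (real (k m) / real m) powr - rate < c"
    using fraction_powr_tendsto[OF k(2) assms(3)] by (intro order_tendstoD) auto
  moreover have "\<forall>\<^sub>F m in sequentially. qerr (k m) g \<le> ennreal (b * real (k m) powr - rate)"
    using assms(1) b(1) k(1) by (auto simp: upper_def intro: eventually_compose_filterlim)
  ultimately show ?thesis
    using eventually_gt_at_top[of 0]
  proof eventually_elim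
    case (elim m)
    have "b * real (k m) powr - rate = b * (real (k m) / real m) powr - rate * real m powr - rate"
      using powr_fraction[OF elim(3), of "k m"] by simp
    also have "\<dots> \<le> c * real m powr - rate"
      using elim by (intro mult_right_mono) auto
    finally show ?case
      using elim by (auto intro: order_trans ennreal_leI)
  qed
qed

lemma fraction_exists:
  assumes "0 < \<theta>" "\<theta> < 1"
  obtains k :: "nat \<Rightarrow> nat" where "\<And>m. k m \<le> m"
    "filterlim k at_top sequentially" "(\<lambda>m. real (k m) / real m) \<longlonglongrightarrow> \<theta>"
    "filterlim (\<lambda>m. m - k m) at_top sequentially"
    "(\<lambda>m. real (m - k m) / real m) \<longlonglongrightarrow> 1 - \<theta>"
proof
  let ?k = "\<lambda>m::nat. nat \<lfloor>\<theta> * real m\<rfloor>"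
  show le: "?k m \<le> m" for m
  proof -
    have "\<lfloor>\<theta> * real m\<rfloor> \<le> \<lfloor>1 * real m\<rfloor>"
      using assms by (intro floor_mono mult_right_mono) auto
    then show ?thesis by simp
  qed
  show "filterlim ?k at_top sequentially"
    using assms by real_asymp
  show lim: "(\<lambda>m. real (?k m) / real m) \<longlonglongrightarrow> \<theta>"
    using assms by real_asymp
  have eq: "\<forall>\<^sub>F m in sequentially. 1 - real (?k m) / real m = real (m - ?k m) / real m"
    using eventually_gt_at_top[of 0]
    by eventually_elim (use le in \<open>simp add: of_nat_diff field_simps\<close>)
  have "(\<lambda>m. 1 - real (?k m) / real m) \<longlonglongrightarrow> 1 - \<theta>"
    by (intro tendsto_intros lim)
  then show lim': "(\<lambda>m. real (m - ?k m) / real m) \<longlonglongrightarrow> 1 - \<theta>"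
    by (rule Lim_transform_eventually[OF _ eq])
  have "filterlim (\<lambda>m. real (m - ?k m) / real m * real m) at_top sequentially"
    using assms by (intro filterlim_tendsto_pos_mult_at_top[OF lim'] filterlim_real_sequentially) auto
  then have "filterlim (\<lambda>m. real (m - ?k m)) at_top sequentially"
    by (rule filterlim_cong[THEN iffD1, rotated -1])
       (auto intro!: eventually_mono[OF eventually_gt_at_top[of 0]])
  then show "filterlim (\<lambda>m. m - ?k m) at_top sequentially"
    by (simp add: filterlim_sequentially_iff_filterlim_real)
qed

lemma upper_add_weighted:
  assumes g: "g \<in> borel_measurable borel" "upper g a" "0 \<le> a"
    and h: "h \<in> borel_measurable borel" "upper h b" "0 \<le> b"
    and "0 < \<theta>" "\<theta> < 1"
  shows "upper (\<lambda>x. g x + h x) (a * \<theta> powr - rate + b * (1 - \<theta>) powr - rate)"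
  unfolding upper_def
proof (intro allI impI)
  fix c let ?a = "a * \<theta> powr - rate" and ?b = "b * (1 - \<theta>) powr - rate"
  assume "?a + ?b < c"
  define e where "e = (c - (?a + ?b)) / 2"
  have e: "0 < e" "c = (?a + e) + (?b + e)" using \<open>?a + ?b < c\<close> by (auto simp: e_def)
  obtain k where k: "\<And>m. k m \<le> m"
    "filterlim k at_top sequentially" "(\<lambda>m. real (k m) / real m) \<longlonglongrightarrow> \<theta>"
    "filterlim (\<lambda>m. m - k m) at_top sequentially"
    "(\<lambda>m. real (m - k m) / real m) \<longlonglongrightarrow> 1 - \<theta>"
    by (rule fraction_exists[OF assms(7,8)]) blast
  have "\<forall>\<^sub>F m in sequentially. qerr (k m) g \<le> ennreal ((?a + e) * real m powr - rate)"
    using e k assms by (intro upper_fraction[of g a \<theta>]) auto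
  moreover have "\<forall>\<^sub>F m in sequentially. qerr (m - k m) h \<le> ennreal ((?b + e) * real m powr - rate)"
    using e k assms by (intro upper_fraction[of h b "1 - \<theta>"]) auto
  ultimately show "\<forall>\<^sub>F m in sequentially. qerr m (\<lambda>x. g x + h x) \<le> ennreal (c * real m powr - rate)"
  proof eventually_elim
    case (elim m)
    have "qerr m (\<lambda>x. g x + h x) = qerr (k m + (m - k m)) (\<lambda>x. g x + h x)"
      using k(1)[of m] by simp
    also have "\<dots> \<le> qerr (k m) g + qerr (m - k m) h"
      by (rule qerr_subadditive[OF g(1) h(1)])
    also have "\<dots> \<le> ennreal ((?a + e) * real m powr - rate) + ennreal ((?b + e) * real m powr - rate)"
      using elim by (intro add_mono)
    also have "\<dots> = ennreal (c * real m powr - rate)"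
      using e(1) g(3) h(3) by (subst ennreal_plus[symmetric]) (auto simp: e(2) distrib_right)
    finally show ?case .
  qed
qed

text \<open>The weight \<open>\<theta> = N / (N + M)\<close> is the optimal allocation of points to the two summands.\<close>

lemma upper_add:
  assumes g: "g \<in> borel_measurable borel" "upper g (q * N powr (1 + rate))" "0 \<le> N"
    and h: "h \<in> borel_measurable borel" "upper h (q * M powr (1 + rate))" "0 \<le> M"
    and q: "0 \<le> q"
  shows "upper (\<lambda>x. g x + h x) (q * (N + M) powr (1 + rate))"
proof (rule upper_powr_limit)
  fix \<epsilon> :: real assume \<epsilon>: "0 < \<epsilon>"
  \<comment> \<open>N or M may be 0, whereas \<theta> must lie strictly between 0 and 1.\<close>
  define N' where "N' = N + \<epsilon> / 2"
  define M' where "M' = M + \<epsilon> / 2"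
  have pos: "0 < N'" "0 < M'" "N + M + \<epsilon> = N' + M'"
    using \<epsilon> g h by (auto simp: N'_def M'_def)
  define \<theta> where "\<theta> = N' / (N' + M')"
  have \<theta>: "0 < \<theta>" "\<theta> < 1" "1 - \<theta> = M' / (N' + M')"
    using pos by (auto simp: \<theta>_def field_simps)
  have "upper g (q * N' powr (1 + rate))"
    by (rule upper_mono[OF g(2)])
      (use g q \<epsilon> rate_pos in \<open>auto intro!: mult_left_mono powr_mono2 simp: N'_def\<close>)
  moreover have "upper h (q * M' powr (1 + rate))"
    by (rule upper_mono[OF h(2)])
      (use h q \<epsilon> rate_pos in \<open>auto intro!: mult_left_mono powr_mono2 simp: M'_def\<close>)
  ultimately have "upper (\<lambda>x. g x + h x) (q * N' powr (1 + rate) * \<theta> powr - rate + q * M' powr (1 + rate) * (1 - \<theta>) powr - rate)"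
    using g h q \<theta> by (intro upper_add_weighted) auto
  also have "q * N' powr (1 + rate) * \<theta> powr - rate = q * N' * (N' + M') powr rate"
    using pos by (simp add: \<theta>_def powr_add powr_minus powr_divide field_simps)
  also have "q * M' powr (1 + rate) * (1 - \<theta>) powr - rate = q * M' * (N' + M') powr rate"
    using pos by (simp add: \<theta> powr_add powr_minus powr_divide field_simps)
  also have "q * N' * (N' + M') powr rate + q * M' * (N' + M') powr rate = q * (N' + M') powr (1 + rate)"
    using pos by (simp add: powr_add algebra_simps)
  finally show "upper (\<lambda>x. g x + h x) (q * (N + M + \<epsilon>) powr (1 + rate))"
    using pos by simp
qed (use g h in auto)

lemma upper_zero: "0 \<le> c \<Longrightarrow> upper (\<lambda>x. 0) c"
  unfolding upper_def
proof (intro allI impI)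
  fix c' :: real assume "0 \<le> c" "c < c'"
  show "\<forall>\<^sub>F m in sequentially. qerr m (\<lambda>x. 0) \<le> ennreal (c' * real m powr - rate)"
    using eventually_gt_at_top[of 0]
  proof eventually_elim
    case (elim m)
    then have "qerr m (\<lambda>x. 0) \<le> distortion {0} (\<lambda>x. 0)"
      by (intro qerr_le) auto
    then show ?case by (simp add: distortion_def)
  qed
qed

lemma upper_sum:
  assumes "finite I" "\<And>i. i \<in> I \<Longrightarrow> g i \<in> borel_measurable borel"
    "\<And>i. i \<in> I \<Longrightarrow> upper (g i) (q * N i powr (1 + rate))" "\<And>i. i \<in> I \<Longrightarrow> 0 \<le> N i" "0 \<le> q"
  shows "upper (\<lambda>x. \<Sum>i\<in>I. g i x) (q * (\<Sum>i\<in>I. N i) powr (1 + rate))"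
  using assms
proof (induction I rule: finite_induct)
  case (insert i I)
  then show ?case
    by (auto intro!: upper_add sum_nonneg borel_measurable_sum)
qed (auto intro: upper_zero)

lemma upper_cmult:
  assumes "g \<in> borel_measurable borel" "upper g c" "0 < a"
  shows "upper (\<lambda>x. ennreal a * g x) (a * c)"
  unfolding upper_def
proof (intro allI impI)
  fix c' assume "a * c < c'"
  then have "\<forall>\<^sub>F m in sequentially. qerr m g \<le> ennreal ((c' / a) * real m powr - rate)"
    using assms(2,3) unfolding upper_def by (auto simp: field_simps dest!: spec[of _ "c' / a"])
  then show "\<forall>\<^sub>F m in sequentially. qerr m (\<lambda>x. ennreal a * g x) \<le> ennreal (c' * real m powr - rate)"
  proof eventually_elim
    case (elim m)
    have "ennreal a * qerr m g \<le> ennreal a * ennreal ((c' / a) * real m powr - rate)"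
      using elim by (rule mult_left_mono) simp
    also have "\<dots> = ennreal (c' * real m powr - rate)"
      using assms(3) by (subst ennreal_mult'[symmetric]) auto
    finally show ?case using qerr_cmult[OF assms(1,3)] by simp
  qed
qed

end

subsection \<open>Nets with growing spacing\<close>

definition coord_grid :: "real set \<Rightarrow> 'a::euclidean_space set"
  where "coord_grid G = {z. \<forall>b\<in>Basis. z \<bullet> b \<in> G}"

lemma coord_grid_eq:
  "coord_grid G = (\<lambda>f. \<Sum>b\<in>Basis. f b *\<^sub>R b) ` (PiE Basis (\<lambda>_. G) :: ('a::euclidean_space \<Rightarrow> real) set)"
proof (intro equalityI subsetI)
  fix z :: 'a assume "z \<in> coord_grid G"
  moreover have "z = (\<Sum>b\<in>Basis. restrict ((\<bullet>) z) Basis b *\<^sub>R b)"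
    by (simp add: euclidean_representation)
  ultimately show "z \<in> (\<lambda>f. \<Sum>b\<in>Basis. f b *\<^sub>R b) ` (PiE Basis (\<lambda>_. G))"
    by (intro image_eqI[of z _ "restrict ((\<bullet>) z) Basis"]) (auto simp: coord_grid_def)
qed (auto simp: coord_grid_def inner_sum_left_Basis PiE_mem)

lemma finite_coord_grid: "finite G \<Longrightarrow> finite (coord_grid G :: 'a::euclidean_space set)"
  unfolding coord_grid_eq by (intro finite_imageI finite_PiE) auto

lemma card_coord_grid_le:
  assumes "finite G"
  shows "card (coord_grid G :: 'a::euclidean_space set) \<le> card G ^ DIM('a)"
proof -
  have "card (coord_grid G :: 'a set) \<le> card (PiE Basis (\<lambda>_. G) :: ('a \<Rightarrow> real) set)"
    unfolding coord_grid_eq using assms by (intro card_image_le finite_PiE) auto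
  then show ?thesis by (simp add: card_PiE)
qed

lemma coord_grid_approx:
  fixes x :: "'a::euclidean_space"
  assumes "\<And>b. b \<in> Basis \<Longrightarrow> \<exists>u\<in>G. \<bar>x \<bullet> b - u\<bar> \<le> e"
  shows "\<exists>z\<in>coord_grid G. dist x z \<le> real DIM('a) * e"
proof -
  from assms obtain u where u: "\<And>b. b \<in> Basis \<Longrightarrow> u b \<in> G \<and> \<bar>x \<bullet> b - u b\<bar> \<le> e" by metis
  let ?z = "\<Sum>b\<in>Basis. u b *\<^sub>R b"
  have "dist x ?z \<le> (\<Sum>b\<in>Basis. \<bar>(x - ?z) \<bullet> b\<bar>)"
    unfolding dist_norm by (rule norm_le_l1)
  also have "\<dots> \<le> (\<Sum>b\<in>(Basis::'a set). e)"
    using u by (intro sum_mono) (simp add: inner_diff_left)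
  finally show ?thesis
    using u by (intro bexI[of _ ?z]) (auto simp: coord_grid_def)
qed

text \<open>Rounding \<open>(1 + t) powr - \<gamma>\<close> up to a multiple of \<open>1/n\<close> gives a set of reals whose
  spacing near \<open>t\<close> is of order \<open>(1 + \<bar>t\<bar>) powr (1 + \<gamma>) / n\<close>.\<close>

lemma real_net_nonneg:
  fixes \<gamma> t :: real
  assumes "0 < \<gamma>" "0 < n" "0 \<le> t"
  shows "\<exists>j\<in>{1..n}. \<bar>t - ((real j / real n) powr - (1 / \<gamma>) - 1)\<bar>
    \<le> 1 / \<gamma> * (1 + t) powr (1 + \<gamma>) / real n"
proof -
  define y where "y = (1 + t) powr - \<gamma>"
  define a where "a = 1 / \<gamma>"
  \<comment> \<open>Rounding up keeps j \<ge> 1, and it places the rounded value to the right of y,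
    where u^(-a) is less steep than at y.\<close>
  define j where "j = nat \<lceil>real n * y\<rceil>"
  define y' where "y' = real j / real n"
  have a: "0 < a" using assms by (simp add: a_def)
  have y: "0 < y" "y \<le> 1"
    using assms powr_mono2'[of "- \<gamma>" 1 "1 + t"] by (auto simp: y_def)
  have ya: "y powr - a = 1 + t"
    using assms by (simp add: y_def a_def powr_powr)
  have ya1: "y powr (- a - 1) = (1 + t) powr (1 + \<gamma>)"
  proof -
    have "- \<gamma> * (- a - 1) = 1 + \<gamma>"
      using assms by (simp add: a_def field_simps)
    then show ?thesis by (simp add: y_def powr_powr)
  qed
  have "0 < real n * y" "real n * y \<le> real n"
    using assms y by (auto simp: mult_le_cancel_left1)
  then have j: "j \<in> {1..n}" "real n * y \<le> real j" "real j < real n * y + 1"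
    unfolding j_def by (auto simp: le_nat_iff ceiling_le_iff nat_le_iff) linarith+
  have y': "y \<le> y'" "y' - y \<le> 1 / real n"
  proof -
    show "y \<le> y'" using j assms by (auto simp: y'_def field_simps)
    have "y' \<le> (real n * y + 1) / real n"
      unfolding y'_def using j by (intro divide_right_mono) auto
    then show "y' - y \<le> 1 / real n" using assms by (simp add: add_divide_distrib)
  qed
  have "0 \<le> y powr - a - y' powr - a"
    using y y' a by (auto intro!: powr_mono2')
  moreover have "y powr - a - y' powr - a \<le> a * y powr (- a - 1) * (y' - y)"
  proof (cases "y = y'")
    case False
    then have "y < y'" using y' by simp
    \<comment> \<open>The slope of u^(-a) on [y, y'] is steepest at y, where its size is a (1 +
      t)^(1+\<gamma>) by \<open>ya1\<close>.\<close>
    have "\<exists>z. y < z \<and> z < y' \<and> y' powr - a - y powr - a = (y' - y) * (- a * z powr (- a - 1))"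
      using \<open>y < y'\<close> y by (intro MVT2) (auto intro!: derivative_eq_intros)
    then obtain z where z: "y < z" "z < y'" "y' powr - a - y powr - a = (y' - y) * (- a * z powr (- a - 1))"
      by blast
    have "z powr (- a - 1) \<le> y powr (- a - 1)"
      using z y a by (intro powr_mono2') auto
    then have "(y' - y) * (a * z powr (- a - 1)) \<le> (y' - y) * (a * y powr (- a - 1))"
      using a y' by (intro mult_left_mono) auto
    then show ?thesis using z(3) by (simp add: mult_ac)
  qed simp
  moreover have "a * y powr (- a - 1) * (y' - y) \<le> a * y powr (- a - 1) * (1 / real n)"
    using a y' by (intro mult_left_mono) auto
  ultimately have "\<bar>t - (y' powr - a - 1)\<bar> \<le> a * (1 + t) powr (1 + \<gamma>) / real n"
    unfolding ya ya1 by simp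
  then show ?thesis
    using j(1) by (auto simp: y'_def a_def)
qed

lemma real_net:
  fixes \<gamma> :: real
  assumes "0 < \<gamma>" "0 < n"
  obtains G where "finite G" "card G \<le> 2 * n"
    "\<And>t. \<exists>u\<in>G. \<bar>t - u\<bar> \<le> 1 / \<gamma> * (1 + \<bar>t\<bar>) powr (1 + \<gamma>) / real n"
proof
  let ?f = "\<lambda>j::nat. (real j / real n) powr - (1 / \<gamma>) - 1"
  let ?G = "?f ` {1..n} \<union> (\<lambda>j. - ?f j) ` {1..n}"
  show "finite ?G" by simp
  have "card ?G \<le> card (?f ` {1..n}) + card ((\<lambda>j. - ?f j) ` {1..n})"
    by (rule card_Un_le)
  also have "\<dots> \<le> card {1..n} + card {1..n}"
    by (intro add_mono card_image_le) auto
  finally show "card ?G \<le> 2 * n" by simp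
  show "\<exists>u\<in>?G. \<bar>t - u\<bar> \<le> 1 / \<gamma> * (1 + \<bar>t\<bar>) powr (1 + \<gamma>) / real n" for t
  proof (cases "0 \<le> t")
    case True
    with real_net_nonneg[OF assms True] show ?thesis by (auto intro: rev_bexI)
  next
    case False
    with real_net_nonneg[OF assms, of "- t"] obtain j where j: "j \<in> {1..n}"
      "\<bar>- t - ?f j\<bar> \<le> 1 / \<gamma> * (1 + - t) powr (1 + \<gamma>) / real n" by auto
    moreover have "\<bar>- t - ?f j\<bar> = \<bar>t - - ?f j\<bar>" by simp
    ultimately have "\<bar>t - - ?f j\<bar> \<le> 1 / \<gamma> * (1 + \<bar>t\<bar>) powr (1 + \<gamma>) / real n"
      using False by simp
    then show ?thesis using j(1) by blast
  qed
qed

text \<open>A product grid over the set from \<open>real_net\<close>. With n = \<lfloor>m^(1/d) /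
  2\<rfloor> there are at most (2n)^d \<le> m points, and m \<ge> 2^d ensures n \<ge> 1. Then n
  \<ge> m^(1/d) / 4, which gives the factor 4; the factor d comes from bounding the norm by the sum
  of the coordinates.\<close>

lemma euclidean_net:
  fixes \<gamma> :: real
  assumes "0 < \<gamma>" "2 ^ DIM('a::euclidean_space) \<le> m"
  obtains Z :: "'a::euclidean_space set" where "finite Z" "Z \<noteq> {}" "card Z \<le> m"
    "\<And>x. infdist x Z \<le> 4 * real DIM('a::euclidean_space) / \<gamma> * (1 + norm x) powr (1 + \<gamma>) * real m powr (- (1 / real DIM('a::euclidean_space)))"
proof -
  let ?d = "real DIM('a)"
  define M where "M = real m powr (1 / ?d)"
  define n where "n = nat \<lfloor>M / 2\<rfloor>"
  have "0 < m" using assms(2) by (metis gr0I le_zero_eq power_not_zero zero_neq_numeral)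
  have Md: "M ^ DIM('a) = real m"
    using \<open>0 < m\<close> by (simp add: M_def powr_realpow[symmetric] powr_powr)
  have "2 ^ DIM('a) \<le> M ^ DIM('a)"
    unfolding Md using assms(2) by (metis of_nat_le_iff of_nat_numeral of_nat_power)
  then have M2: "2 \<le> M"
    by (subst (asm) power_mono_iff) (auto simp: M_def)
  then have "1 \<le> \<lfloor>M / 2\<rfloor>" by (simp add: le_floor_iff)
  then have n: "0 < n" "2 * real n \<le> M" "M / 4 \<le> real n"
    unfolding n_def by linarith+
  obtain G where G: "finite G" "card G \<le> 2 * n"
    "\<And>t. \<exists>u\<in>G. \<bar>t - u\<bar> \<le> 1 / \<gamma> * (1 + \<bar>t\<bar>) powr (1 + \<gamma>) / real n"
    using real_net[OF assms(1) n(1)] by blast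
  let ?Z = "coord_grid G :: 'a set"
  have approx: "\<exists>z\<in>?Z. dist x z \<le> ?d * (1 / \<gamma> * (1 + norm x) powr (1 + \<gamma>) / real n)" for x
  proof (rule coord_grid_approx)
    fix b :: 'a assume b: "b \<in> Basis"
    from G(3)[of "x \<bullet> b"] obtain u where u: "u \<in> G"
      "\<bar>x \<bullet> b - u\<bar> \<le> 1 / \<gamma> * (1 + \<bar>x \<bullet> b\<bar>) powr (1 + \<gamma>) / real n" by blast
    have "1 / \<gamma> * (1 + \<bar>x \<bullet> b\<bar>) powr (1 + \<gamma>) / real n \<le> 1 / \<gamma> * (1 + norm x) powr (1 + \<gamma>) / real n"
      using b assms n Basis_le_norm[OF b, of x]
      by (intro divide_right_mono mult_left_mono powr_mono2) auto
    with u show "\<exists>u\<in>G. \<bar>x \<bullet> b - u\<bar> \<le> 1 / \<gamma> * (1 + norm x) powr (1 + \<gamma>) / real n"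
      by (intro bexI[of _ u]) auto
  qed
  show thesis
  proof
    show "finite ?Z" by (rule finite_coord_grid[OF G(1)])
    show "?Z \<noteq> {}" using approx by blast
    have "real (card ?Z) \<le> real ((2 * n) ^ DIM('a))"
      using card_coord_grid_le[OF G(1), where 'a='a] power_mono[OF G(2), of "DIM('a)"] by linarith
    also have "\<dots> \<le> M ^ DIM('a)"
      using power_mono[OF n(2), of "DIM('a)"] by simp
    finally show "card ?Z \<le> m" by (simp add: Md)
    show "infdist x ?Z \<le> 4 * ?d / \<gamma> * (1 + norm x) powr (1 + \<gamma>) * real m powr (- (1 / ?d))" for x
    proof -
      have "infdist x ?Z \<le> (?d / \<gamma> * (1 + norm x) powr (1 + \<gamma>)) * (1 / real n)"
        using approx[of x] by (auto intro: infdist_le2)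
      also have "\<dots> \<le> (?d / \<gamma> * (1 + norm x) powr (1 + \<gamma>)) * (4 / M)"
        using n M2 assms by (intro mult_left_mono) (auto simp: field_simps)
      finally show ?thesis by (simp add: M_def powr_minus field_simps)
    qed
  qed
qed

context quantization
begin

text \<open>A substitute for Pierce's lemma. The bound is linear in \<open>g\<close>, so it controls the remainder of an
  approximation in weighted \<open>L\<^sup>1\<close>.\<close>

lemma upper_moment:
  assumes "0 < \<delta>"
  obtains K where "0 \<le> K"
    "\<And>g I. g \<in> borel_measurable borel \<Longrightarrow> 0 \<le> I \<Longrightarrow>
      (\<integral>\<^sup>+x. ennreal ((1 + norm x) powr (r + \<delta>)) * g x \<partial>lborel) \<le> ennreal I \<Longrightarrow> upper g (K * I)"
proof
  \<comment> \<open>With this \<gamma> the r-th power of the net's spacing is a multiple of the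
    weight (1 + |x|)^(r+\<delta>).\<close>
  define \<gamma> where "\<gamma> = \<delta> / r"
  have \<gamma>: "0 < \<gamma>" "(1 + \<gamma>) * r = r + \<delta>" using assms r_pos by (auto simp: \<gamma>_def field_simps)
  define A where "A = 4 * real DIM('a) / \<gamma>"
  define K where "K = A powr r"
  show "0 \<le> K" by (simp add: K_def)
  fix g :: "'a \<Rightarrow> ennreal" and I :: real
  assume [measurable]: "g \<in> borel_measurable borel" and "0 \<le> I"
    and I: "(\<integral>\<^sup>+x. ennreal ((1 + norm x) powr (r + \<delta>)) * g x \<partial>lborel) \<le> ennreal I"
  have "qerr m g \<le> ennreal (K * I * real m powr - rate)" if m: "2 ^ DIM('a) \<le> m" for m
  proof -
    obtain Z :: "'a set" where Z: "finite Z" "Z \<noteq> {}" "card Z \<le> m"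
      "\<And>x. infdist x Z \<le> 4 * real DIM('a) / \<gamma> * (1 + norm x) powr (1 + \<gamma>) * real m powr (- (1 / real DIM('a)))"
      using euclidean_net[OF \<gamma>(1) m] by blast
    have "0 \<le> A" using \<gamma>(1) by (simp add: A_def)
    have *: "infdist x Z powr r \<le> K * real m powr - rate * (1 + norm x) powr (r + \<delta>)" for x
    proof -
      have "infdist x Z powr r \<le> (A * (1 + norm x) powr (1 + \<gamma>) * real m powr (- (1 / real DIM('a)))) powr r"
        using Z(4) r_pos unfolding A_def by (intro powr_mono2 infdist_nonneg) auto
      also have "\<dots> = A powr r * (1 + norm x) powr ((1 + \<gamma>) * r) * real m powr - rate"
        using \<open>0 \<le> A\<close> by (simp add: powr_mult powr_powr rate_def)
      finally show ?thesis unfolding \<gamma>(2) K_def by (simp add: mult_ac)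
    qed
    have "qerr m g \<le> distortion Z g" by (rule qerr_le[OF Z(1-3)])
    also have "\<dots> \<le> (\<integral>\<^sup>+x. ennreal (K * real m powr - rate) * (ennreal ((1 + norm x) powr (r + \<delta>)) * g x) \<partial>lborel)"
      unfolding distortion_def mult.assoc[symmetric]
      using * by (intro nn_integral_mono mult_right_mono) (auto simp: ennreal_mult[symmetric] K_def intro!: ennreal_leI)
    also have "\<dots> = ennreal (K * real m powr - rate) * (\<integral>\<^sup>+x. (ennreal ((1 + norm x) powr (r + \<delta>)) * g x) \<partial>lborel)"
      by (rule nn_integral_cmult) measurable
    also have "\<dots> \<le> ennreal (K * real m powr - rate) * ennreal I"
      using I by (rule mult_left_mono) simp
    finally show ?thesis
      using \<open>0 \<le> I\<close> by (simp add: ennreal_mult[symmetric] K_def mult_ac)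
  qed
  then have *: "\<forall>\<^sub>F m in sequentially. qerr m g \<le> ennreal (K * I * real m powr - rate)"
    by (auto intro: eventually_sequentiallyI)
  show "upper g (K * I)"
    unfolding upper_def
  proof (intro allI impI)
    fix c assume "K * I < c"
    then have "ennreal (K * I * real m powr - rate) \<le> ennreal (c * real m powr - rate)" for m
      by (intro ennreal_leI mult_right_mono) auto
    with * show "\<forall>\<^sub>F m in sequentially. qerr m g \<le> ennreal (c * real m powr - rate)"
      by (auto elim!: eventually_mono intro: order_trans)
  qed
qed

end

subsection \<open>The unit cube\<close>

context quantization
begin

abbreviation cube :: "'a \<Rightarrow> real \<Rightarrow> 'a set"
  where "cube t h \<equiv> cbox t (t + h *\<^sub>R One)"

definition cube_err :: "nat \<Rightarrow> ennreal"
  where "cube_err m = qerr m (indicator (cube 0 1))"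

text \<open>As an infimum the constant gives \<open>cube_err_ge\<close> for every k > 0;
  \<open>upper_unit_cube\<close> shows that it is also the asymptotic value. The index k = 0 has to
  be excluded because it would contribute 0. For k \<ge> 1 the conversion by \<open>enn2real\<close>
  loses nothing, by \<open>cube_err_finite\<close>.\<close>

definition quantization_const :: real
  where "quantization_const = (INF k\<in>{1..}. real k powr rate * enn2real (cube_err k))"

lemma emeasure_cube: "0 \<le> h \<Longrightarrow> emeasure lborel (cube t h) = ennreal (h ^ DIM('a))"
  by (subst emeasure_lborel_cbox) (auto simp: inner_simps)

lemma qerr_cube:
  assumes "0 < h"
  shows "qerr m (indicator (cube t h)) = ennreal (h powr (real DIM('a) + r)) * cube_err m"
proof -
  have "indicator (cube t h) (t + h *\<^sub>R x) = (indicator (cube 0 1) x :: ennreal)" for x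
    using assms by (auto simp: indicator_def mem_box inner_simps mult_le_cancel_left1 zero_le_mult_iff)
  then show ?thesis
    unfolding cube_err_def by (subst qerr_affine[OF _ assms, of _ m t]) auto
qed

text \<open>Cut the cube into n^d cubes of side 1/n and give each of them k points. One small cube
  costs n^(-d-r) times \<open>cube_err k\<close>.\<close>

lemma cube_err_tiling:
  assumes "0 < n"
  shows "cube_err (n ^ DIM('a) * k) \<le> ennreal (real n powr - r) * cube_err k"
proof -
  define G where "G = real ` {..<n}"
  define h where "h = 1 / real n"
  let ?I = "coord_grid G :: 'a set"
  have h: "0 < h" using assms by (simp add: h_def)
  have fin: "finite ?I" by (rule finite_coord_grid) (simp add: G_def)
  have "card G \<le> n" using card_image_le[of "{..<n}" real] by (simp add: G_def)
  then have card: "card ?I \<le> n ^ DIM('a)"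
    by (intro order_trans[OF card_coord_grid_le power_mono]) (auto simp: G_def)
  have ne: "?I \<noteq> {}"
    using assms by (auto simp: coord_grid_def G_def intro!: exI[of _ 0] image_eqI[of _ _ 0])
  \<comment> \<open>An inequality, since the closed small cubes overlap in their faces.\<close>
  have le: "indicator (cube 0 1) x \<le> (\<Sum>v\<in>?I. indicator (cube (h *\<^sub>R v) h) x :: ennreal)" for x
  proof (cases "x \<in> cube 0 1")
    case True
    have "\<exists>i<n. real i * h \<le> x \<bullet> b \<and> x \<bullet> b \<le> real i * h + h" if "b \<in> Basis" for b
    proof (cases "x \<bullet> b < 1")
      case xb: True
      let ?i = "nat \<lfloor>real n * (x \<bullet> b)\<rfloor>"
      have *: "0 \<le> x \<bullet> b" using True that by (auto simp: mem_box)
      have "real n * (x \<bullet> b) < real n" using xb assms by (simp add: mult_less_cancel_left2)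
      then have "?i < n" using * assms by (simp add: nat_less_iff floor_less_iff)
      moreover have "real ?i \<le> real n * (x \<bullet> b)" "real n * (x \<bullet> b) \<le> real ?i + 1"
        using * by (auto simp: of_nat_nat)
      ultimately show ?thesis using assms by (intro exI[of _ ?i]) (auto simp: h_def field_simps)
    next
      \<comment> \<open>A coordinate equal to 1 would be rounded to the index n, outside the grid;
        it belongs to the last cell.\<close>
      case False
      moreover have "x \<bullet> b \<le> 1" using True that by (auto simp: mem_box)
      ultimately have "x \<bullet> b = 1" by simp
      then show ?thesis
        using assms by (intro exI[of _ "n - 1"]) (auto simp: h_def field_simps)
    qed
    then obtain i where i: "\<And>b. b \<in> Basis \<Longrightarrow> i b < n \<and> real (i b) * h \<le> x \<bullet> b \<and> x \<bullet> b \<le> real (i b) * h + h"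
      by metis
    let ?v = "\<Sum>b\<in>Basis. real (i b) *\<^sub>R b :: 'a"
    have v: "?v \<in> ?I" using i by (auto simp: coord_grid_def G_def)
    have "x \<in> cube (h *\<^sub>R ?v) h" using i by (auto simp: mem_box inner_simps mult.commute)
    then have "1 \<le> (\<Sum>v\<in>{?v}. indicator (cube (h *\<^sub>R v) h) x :: ennreal)" by simp
    also have "\<dots> \<le> (\<Sum>v\<in>?I. indicator (cube (h *\<^sub>R v) h) x)"
      using fin v by (intro sum_mono2) auto
    finally show ?thesis using True by simp
  qed simp
  have "cube_err (n ^ DIM('a) * k) \<le> qerr (\<Sum>v\<in>?I. k) (\<lambda>x. \<Sum>v\<in>?I. indicator (cube (h *\<^sub>R v) h) x)"
    unfolding cube_err_def using le card by (intro qerr_mono) auto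
  also have "\<dots> \<le> (\<Sum>v\<in>?I. qerr k (indicator (cube (h *\<^sub>R v) h)))"
    using fin ne by (intro qerr_sum_le) auto
  also have "\<dots> = of_nat (card ?I) * (ennreal (h powr (real DIM('a) + r)) * cube_err k)"
    by (subst qerr_cube[OF h]) simp
  also have "\<dots> \<le> of_nat (n ^ DIM('a)) * (ennreal (h powr (real DIM('a) + r)) * cube_err k)"
    using card by (intro mult_right_mono) (auto simp flip: of_nat_power)
  also have "\<dots> = ennreal (real n ^ DIM('a) * h powr (real DIM('a) + r)) * cube_err k"
    by (simp add: ennreal_mult' mult.assoc ennreal_of_nat_eq_real_of_nat flip: ennreal_power)
  also have "real n ^ DIM('a) * h powr (real DIM('a) + r) = real n powr - r"
    using assms by (simp add: h_def powr_divide powr_add powr_minus powr_realpow field_simps)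
  finally show ?thesis .
qed

lemma cube_err_finite:
  assumes "0 < k"
  shows "cube_err k < \<top>"
proof -
  have "cube_err k \<le> distortion {0} (indicator (cube 0 1))"
    unfolding cube_err_def using assms by (intro qerr_le) auto
  also have "\<dots> \<le> (\<integral>\<^sup>+x. ennreal (real DIM('a) powr r) * indicator (cube 0 1) x \<partial>lborel)"
    unfolding distortion_def
  proof (rule nn_integral_mono)
    fix x :: 'a
    have "infdist x {0} powr r \<le> real DIM('a) powr r" if "x \<in> cube 0 1"
    proof -
      have "norm x \<le> (\<Sum>b\<in>Basis. \<bar>x \<bullet> b\<bar>)" by (rule norm_le_l1)
      also have "\<dots> \<le> (\<Sum>b\<in>(Basis::'a set). 1)"
        using that by (intro sum_mono) (auto simp: mem_box)
      finally show ?thesis using r_pos by (intro powr_mono2) auto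
    qed
    then show "ennreal (infdist x {0} powr r) * indicator (cube 0 1) x
      \<le> ennreal (real DIM('a) powr r) * indicator (cube 0 1) x"
      by (auto simp: indicator_def intro: ennreal_leI)
  qed
  also have "\<dots> = ennreal (real DIM('a) powr r) * emeasure lborel (cube 0 1)"
    by (subst nn_integral_cmult_indicator) auto
  also have "\<dots> < \<top>" by (simp add: emeasure_cube ennreal_mult_less_top)
  finally show ?thesis .
qed

text \<open>The balls of radius \<open>\<tau>\<close> around the \<open>k\<close> points, with \<open>\<tau>\<close> chosen such that
  \<open>k (2 \<tau>) ^ d = 1/2\<close>, leave half of the cube uncovered.\<close>

lemma cube_err_lower_bound:
  assumes "0 < k"
  shows "ennreal (2 powr (- rate - r - 1) * real k powr - rate) \<le> cube_err k"
  unfolding cube_err_def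
proof (rule qerr_greatest)
  fix Z :: "'a set" assume Z: "finite Z" "Z \<noteq> {}" "card Z \<le> k"
  define \<tau> where "\<tau> = (2 * real k) powr (- (1 / real DIM('a))) / 2"
  have \<tau>: "0 < \<tau>" using assms by (simp add: \<tau>_def)
  have \<tau>d: "(2 * \<tau>) ^ DIM('a) = 1 / (2 * real k)"
    using assms by (simp add: \<tau>_def powr_realpow[symmetric] powr_powr powr_minus field_simps)
  have \<tau>r: "\<tau> powr r = 2 powr (- rate - r) * real k powr - rate"
  proof -
    have "\<tau> powr r = (2 * real k) powr (- (1 / real DIM('a)) * r) / 2 powr r"
      by (simp add: \<tau>_def powr_divide powr_powr)
    also have "- (1 / real DIM('a)) * r = - rate" by (simp add: rate_def)
    finally show ?thesis by (simp add: powr_mult powr_diff)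
  qed
  \<comment> \<open>Each ball is enlarged to the circumscribed cube, whose volume is explicit.
    Outside that cube some coordinate already differs by more than \<tau>.\<close>
  define B where "B = (\<Union>z\<in>Z. cube (z - \<tau> *\<^sub>R One) (2 * \<tau>))"
  have [measurable]: "B \<in> sets borel" using Z by (auto simp: B_def)
  have "emeasure lborel B \<le> (\<Sum>z\<in>Z. emeasure lborel (cube (z - \<tau> *\<^sub>R One) (2 * \<tau>)))"
    unfolding B_def using Z by (intro emeasure_subadditive_finite) auto
  also have "\<dots> = ennreal (real (card Z) * (1 / (2 * real k)))"
    using \<tau> emeasure_cube[of "2 * \<tau>"]
    unfolding \<tau>d by (simp add: ennreal_of_nat_eq_real_of_nat ennreal_mult'[symmetric])
  also have "\<dots> \<le> ennreal (1/2)"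
    using Z assms by (intro ennreal_leI) (simp add: field_simps)
  finally have B: "emeasure lborel B \<le> ennreal (1/2)" .
  have far: "\<tau> \<le> infdist x Z" if "x \<notin> B" for x
  proof -
    have "\<tau> \<le> dist x z" if "z \<in> Z" for z
    proof -
      have "x \<notin> cube (z - \<tau> *\<^sub>R One) (2 * \<tau>)" using \<open>x \<notin> B\<close> \<open>z \<in> Z\<close> by (auto simp: B_def)
      then obtain b where b: "b \<in> Basis" "\<not> (z \<bullet> b - \<tau> \<le> x \<bullet> b \<and> x \<bullet> b \<le> z \<bullet> b + \<tau>)"
        by (auto simp: mem_box inner_simps)
      then have "\<tau> \<le> \<bar>(x - z) \<bullet> b\<bar>" by (auto simp: inner_simps)
      also have "\<dots> \<le> dist x z" unfolding dist_norm by (rule Basis_le_norm[OF b(1)])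
      finally show ?thesis .
    qed
    then show ?thesis using Z(2) by (auto simp: infdist_def intro: cINF_greatest)
  qed
  have "1 \<le> emeasure lborel (cube 0 1 - B) + emeasure lborel B"
    using emeasure_subadditive[of "cube 0 1 - B" lborel B] emeasure_cube[of 1 0]
      emeasure_mono[of "cube 0 1" "cube 0 1 - B \<union> B" lborel] by (auto intro: order_trans)
  also have "\<dots> \<le> emeasure lborel (cube 0 1 - B) + ennreal (1/2)"
    using B by (rule add_left_mono)
  finally have *: "1 \<le> emeasure lborel (cube 0 1 - B) + ennreal (1/2)" .
  have half: "ennreal (1/2) \<le> emeasure lborel (cube 0 1 - B)"
  proof (cases "emeasure lborel (cube 0 1 - B)")
    case (real a)
    with * have "ennreal 1 \<le> ennreal (a + 1/2)" by (subst ennreal_plus) auto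
    then have "1/2 \<le> a" using real by (subst (asm) ennreal_le_iff) auto
    then show ?thesis unfolding real(2) by (rule ennreal_leI)
  qed simp
  have "ennreal (2 powr (- rate - r - 1) * real k powr - rate) = ennreal (\<tau> powr r) * ennreal (1/2)"
    unfolding \<tau>r by (subst ennreal_mult[symmetric]) (auto simp: powr_diff)
  also have "\<dots> \<le> ennreal (\<tau> powr r) * emeasure lborel (cube 0 1 - B)"
    using half by (rule mult_left_mono) simp
  also have "\<dots> = (\<integral>\<^sup>+x. ennreal (\<tau> powr r) * indicator (cube 0 1 - B) x \<partial>lborel)"
    by (subst nn_integral_cmult_indicator) auto
  also have "\<dots> \<le> distortion Z (indicator (cube 0 1))"
    unfolding distortion_def using far \<tau> r_pos
    by (intro nn_integral_mono) (auto simp: indicator_def intro!: ennreal_leI powr_mono2)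
  finally show "ennreal (2 powr (- rate - r - 1) * real k powr - rate) \<le> distortion Z (indicator (cube 0 1))" .
qed

lemma quantization_const_le:
  assumes "0 < k"
  shows "quantization_const \<le> real k powr rate * enn2real (cube_err k)"
  unfolding quantization_const_def
  using assms by (intro cINF_lower bdd_belowI[of _ 0]) auto

lemma quantization_const_pos: "0 < quantization_const"
proof -
  have "2 powr (- rate - r - 1) \<le> real k powr rate * enn2real (cube_err k)" if "0 < k" for k
  proof -
    have "2 powr (- rate - r - 1) * real k powr - rate \<le> enn2real (cube_err k)"
      using enn2real_mono[OF cube_err_lower_bound[OF that] cube_err_finite[OF that]] by simp
    then show ?thesis
      using that by (simp add: powr_minus field_simps)
  qed
  then have "2 powr (- rate - r - 1) \<le> quantization_const"
    unfolding quantization_const_def by (intro cINF_greatest) auto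
  moreover have "0 < 2 powr (- rate - r - 1)" by simp
  ultimately show ?thesis by linarith
qed

lemma cube_err_ge:
  assumes "0 < k"
  shows "ennreal (quantization_const * real k powr - rate) \<le> cube_err k"
proof -
  have "quantization_const * real k powr - rate \<le> enn2real (cube_err k)"
    using quantization_const_le[OF assms] assms by (simp add: powr_minus field_simps)
  then show ?thesis
    using cube_err_finite[OF assms] by (metis ennreal_enn2real ennreal_leI)
qed

text \<open>Take a k whose normalized error is close to the infimum and tile with n^d cubes of k
  points each, where n = \<lfloor>(m/k)^(1/d)\<rfloor>. At most m points are used, and nothing is
  lost in the limit because n is asymptotic to (m/k)^(1/d).\<close>

lemma upper_unit_cube: "upper (indicator (cube 0 1)) quantization_const"
  unfolding upper_def cube_err_def[symmetric]
proof (intro allI impI)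
  fix c assume "quantization_const < c"
  then obtain k where k: "0 < k" "real k powr rate * enn2real (cube_err k) < c"
    unfolding quantization_const_def
    by (subst (asm) cINF_less_iff) (auto intro!: bdd_belowI[of _ 0] simp: Suc_le_eq)
  define u where "u = real k powr rate * enn2real (cube_err k)"
  have u: "cube_err k = ennreal (u * real k powr - rate)" "0 \<le> u"
    using k(1) cube_err_finite[OF k(1)] by (auto simp: u_def powr_minus field_simps)
  define y where "y = (\<lambda>m. (real m / real k) powr (1 / real DIM('a)))"
  define n where "n = (\<lambda>m. nat \<lfloor>y m\<rfloor>)"
  have "filterlim y at_top sequentially"
    unfolding y_def using k(1) by real_asymp
  moreover have "((\<lambda>y::real. u * (real (nat \<lfloor>y\<rfloor>) / y) powr - r) \<longlongrightarrow> u * 1 powr - r) at_top"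
    by (rule tendsto_intros | real_asymp | simp)+
  ultimately have "(\<lambda>m. u * (real (n m) / y m) powr - r) \<longlonglongrightarrow> u"
    unfolding n_def by (auto dest: filterlim_compose)
  then have "\<forall>\<^sub>F m in sequentially. u * (real (n m) / y m) powr - r < c"
    using k(2) by (intro order_tendstoD) (auto simp: u_def)
  then show "\<forall>\<^sub>F m in sequentially. cube_err m \<le> ennreal (c * real m powr - rate)"
    using eventually_ge_at_top[of k]
  proof eventually_elim
    case (elim m)
    have y: "1 \<le> y m" using elim(2) k(1) by (auto simp: y_def intro!: ge_one_powr_ge_zero)
    then have "1 \<le> \<lfloor>y m\<rfloor>" by (simp add: le_floor_iff)
    then have n: "0 < n m" "real (n m) \<le> y m" unfolding n_def by linarith+
    have "real (n m) ^ DIM('a) \<le> y m ^ DIM('a)"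
      using n by (intro power_mono) auto
    also have "\<dots> = real m / real k"
      using k(1) elim(2) by (simp add: y_def powr_realpow[symmetric] powr_powr)
    finally have "real (n m ^ DIM('a) * k) \<le> real m"
      using k(1) by (simp add: field_simps)
    then have "cube_err m \<le> cube_err (n m ^ DIM('a) * k)"
      unfolding cube_err_def by (intro qerr_mono) (auto simp only: of_nat_le_iff)
    also have "\<dots> \<le> ennreal (real (n m) powr - r) * cube_err k"
      by (rule cube_err_tiling[OF n(1)])
    also have "\<dots> = ennreal (real (n m) powr - r * u * real k powr - rate)"
      using u by (simp add: ennreal_mult[symmetric] mult_ac)
    also have "real (n m) powr - r = (real (n m) / y m) powr - r * y m powr - r"
      using n y by (simp add: powr_divide)
    also have "y m powr - r = real m powr - rate * real k powr rate"
      using k(1) by (simp add: y_def powr_powr rate_def powr_divide powr_minus field_simps)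
    also have "(real (n m) / y m) powr - r * (real m powr - rate * real k powr rate) * u * real k powr - rate
        = u * (real (n m) / y m) powr - r * real m powr - rate"
      using k(1) by (simp add: powr_minus)
    also have "ennreal \<dots> \<le> ennreal (c * real m powr - rate)"
      using elim by (intro ennreal_leI mult_right_mono) auto
    finally show ?case .
  qed
qed

text \<open>Rewrites the scaling factor as a power of the volume, which puts cubes into the form
  N^(1+rate) of \<open>upper_add\<close>.\<close>

lemma side_powr:
  assumes "0 < h"
  shows "h powr (real DIM('a) + r) = (h ^ DIM('a)) powr (1 + rate)"
proof -
  have "real DIM('a) * (1 + rate) = real DIM('a) + r" by (simp add: rate_def field_simps)
  then show ?thesis using assms by (simp add: powr_realpow[symmetric] powr_powr)
qed

lemma upper_cube:
  assumes "0 < h"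
  shows "upper (indicator (cube t h)) (quantization_const * (h ^ DIM('a)) powr (1 + rate))"
  unfolding upper_def
proof (intro allI impI)
  let ?s = "h powr (real DIM('a) + r)"
  have s: "0 < ?s" using assms by simp
  fix c assume "quantization_const * (h ^ DIM('a)) powr (1 + rate) < c"
  then have "quantization_const < c / ?s"
    using s by (simp add: side_powr[OF assms, symmetric] field_simps)
  with upper_unit_cube have "\<forall>\<^sub>F m in sequentially. cube_err m \<le> ennreal (c / ?s * real m powr - rate)"
    by (simp only: upper_def cube_err_def)
  then show "\<forall>\<^sub>F m in sequentially. qerr m (indicator (cube t h)) \<le> ennreal (c * real m powr - rate)"
  proof eventually_elim
    case (elim m)
    then have "ennreal ?s * cube_err m \<le> ennreal ?s * ennreal (c / ?s * real m powr - rate)"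
      by (rule mult_left_mono) simp
    also have "\<dots> = ennreal (c * real m powr - rate)"
      using s by (subst ennreal_mult'[symmetric]) auto
    finally show ?case by (simp add: qerr_cube[OF assms])
  qed
qed

lemma qerr_cube_ge:
  assumes "0 < h" "0 < m"
  shows "ennreal (quantization_const * (h ^ DIM('a)) powr (1 + rate) * real m powr - rate)
    \<le> qerr m (indicator (cube t h))"
proof -
  have "ennreal (h powr (real DIM('a) + r)) * ennreal (quantization_const * real m powr - rate)
    \<le> ennreal (h powr (real DIM('a) + r)) * cube_err m"
    using cube_err_ge[OF assms(2)] by (rule mult_left_mono) simp
  then show ?thesis
    using quantization_const_pos
    by (simp add: qerr_cube[OF assms(1)] side_powr[OF assms(1), symmetric] ennreal_mult[symmetric] mult_ac)
qed

end

subsection \<open>Bounded sets\<close>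

text \<open>Radon's inequality: no allocation of points beats the proportional one. It is Jensen's
  inequality for x^(1+\<rho>) with weights k i / K at the points N i / k i.\<close>

lemma sum_powr_ge:
  fixes N k :: "'i \<Rightarrow> real"
  assumes "finite I" "I \<noteq> {}" "\<And>i. i \<in> I \<Longrightarrow> 0 \<le> N i" "\<And>i. i \<in> I \<Longrightarrow> 0 < k i" "0 \<le> \<rho>"
  shows "(\<Sum>i\<in>I. N i) powr (1 + \<rho>) * (\<Sum>i\<in>I. k i) powr - \<rho> \<le> (\<Sum>i\<in>I. N i powr (1 + \<rho>) * k i powr - \<rho>)"
proof -
  \<comment> \<open>Convexity is applied on the positive reals. Dropping the indices with N i = 0
    only decreases the sum of the k i, hence increases its power with exponent -\<rho>.\<close>
  define J where "J = {i\<in>I. 0 < N i}"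
  have J: "finite J" "J \<subseteq> I" "\<And>i. i \<in> J \<Longrightarrow> 0 < N i \<and> 0 < k i"
    using assms by (auto simp: J_def)
  have sumN: "(\<Sum>i\<in>I. N i) = (\<Sum>i\<in>J. N i)"
    using assms J by (intro sum.mono_neutral_right) (auto simp: J_def less_le)
  show ?thesis
  proof (cases "J = {}")
    case True
    then show ?thesis unfolding sumN by (auto intro!: sum_nonneg)
  next
    case False
    define K where "K = (\<Sum>i\<in>J. k i)"
    have K: "0 < K" unfolding K_def using J False by (intro sum_pos) auto
    have "K \<le> (\<Sum>i\<in>I. k i)"
      unfolding K_def using assms(1,4) J(2) by (intro sum_mono2) (auto intro: less_imp_le)
    then have "(\<Sum>i\<in>I. N i) powr (1 + \<rho>) * (\<Sum>i\<in>I. k i) powr - \<rho> \<le> (\<Sum>i\<in>J. N i) powr (1 + \<rho>) * K powr - \<rho>"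
      unfolding sumN using K assms(5) by (intro mult_left_mono powr_mono2') auto
    also have "\<dots> \<le> (\<Sum>i\<in>J. N i powr (1 + \<rho>) * k i powr - \<rho>)"
    proof -
      have "(\<lambda>x. x powr (1 + \<rho>)) (\<Sum>i\<in>J. (k i / K) *\<^sub>R (N i / k i))
          \<le> (\<Sum>i\<in>J. (k i / K) * (\<lambda>x. x powr (1 + \<rho>)) (N i / k i))"
        using J False K assms(5)
        by (intro convex_on_sum[where C="{0<..}"] powr_convex)
          (auto simp: K_def intro: less_imp_le simp flip: sum_divide_distrib)
      also have "(\<Sum>i\<in>J. (k i / K) *\<^sub>R (N i / k i)) = (\<Sum>i\<in>J. N i) / K"
        unfolding sum_divide_distrib using J(3) by (intro sum.cong) force+
      also have "(\<Sum>i\<in>J. (k i / K) * (N i / k i) powr (1 + \<rho>)) = (\<Sum>i\<in>J. N i powr (1 + \<rho>) * k i powr - \<rho>) / K"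
        unfolding sum_divide_distrib
      proof (intro sum.cong refl)
        fix i assume "i \<in> J"
        with J(3) have "0 < N i" "0 < k i" by auto
        then show "(k i / K) * (N i / k i) powr (1 + \<rho>) = N i powr (1 + \<rho>) * k i powr - \<rho> / K"
          by (simp add: powr_divide powr_add powr_minus field_simps)
      qed
      finally have "K * ((\<Sum>i\<in>J. N i) / K) powr (1 + \<rho>) \<le> (\<Sum>i\<in>J. N i powr (1 + \<rho>) * k i powr - \<rho>)"
        using K by (simp add: field_simps)
      also have "((\<Sum>i\<in>J. N i) / K) powr (1 + \<rho>) = (\<Sum>i\<in>J. N i) powr (1 + \<rho>) / K powr (1 + \<rho>)"
        by (rule powr_divide)
      finally show ?thesis
        using K by (simp add: powr_add powr_minus field_simps)
    qed
    also have "\<dots> \<le> (\<Sum>i\<in>I. N i powr (1 + \<rho>) * k i powr - \<rho>)"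
      using assms(1) J(2) by (intro sum_mono2) auto
    finally show ?thesis .
  qed
qed

lemma disjoint_compact_family_separated:
  fixes A :: "'i \<Rightarrow> 'a::heine_borel set"
  assumes "finite I" "\<And>i. i \<in> I \<Longrightarrow> compact (A i)" "disjoint_family_on A I"
  obtains \<eta> where "0 < \<eta>"
    "\<And>i j x y. i \<in> I \<Longrightarrow> j \<in> I \<Longrightarrow> i \<noteq> j \<Longrightarrow> x \<in> A i \<Longrightarrow> y \<in> A j \<Longrightarrow> \<eta> \<le> dist x y"
proof -
  let ?P = "{p \<in> I \<times> I. fst p \<noteq> snd p}"
  have "\<exists>d>0. \<forall>x\<in>A (fst p). \<forall>y\<in>A (snd p). d \<le> dist x y" if "p \<in> ?P" for p
    using separate_compact_closed[of "A (fst p)" "A (snd p)"] that assms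
    by (force simp: disjoint_family_on_def compact_imp_closed)
  then have "\<exists>d. \<forall>p\<in>?P. 0 < d p \<and> (\<forall>x\<in>A (fst p). \<forall>y\<in>A (snd p). d p \<le> dist x y)"
    by (intro bchoice) blast
  then obtain d where d: "\<forall>p\<in>?P. 0 < d p \<and> (\<forall>x\<in>A (fst p). \<forall>y\<in>A (snd p). d p \<le> dist x y)"
    by (rule exE)
  \<comment> \<open>The 1 keeps the set nonempty when there are no two distinct indices.\<close>
  define \<eta> where "\<eta> = Min (insert 1 (d ` ?P))"
  have fin: "finite (insert 1 (d ` ?P))" using assms(1) by auto
  show thesis
  proof
    show "0 < \<eta>" unfolding \<eta>_def using d fin by (subst Min_gr_iff) auto
    fix i j x y assume ij: "i \<in> I" "j \<in> I" "i \<noteq> j" and xy: "x \<in> A i" "y \<in> A j"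
    have "\<eta> \<le> d (i, j)" unfolding \<eta>_def using fin ij by (intro Min_le) auto
    also have "\<dots> \<le> dist x y" using d[rule_format, of "(i, j)"] ij xy by auto
    finally show "\<eta> \<le> dist x y" .
  qed
qed

text \<open>Monotone convergence for simple functions cut off at growing radii, which makes the
  level sets bounded. The levels index their own sets, so I consists of values. The weight v is 1
  for the lower bound and the moment weight for the upper bound.\<close>

lemma simple_approximation_from_below:
  fixes f :: "'a::euclidean_space \<Rightarrow> real" and v :: "'a \<Rightarrow> ennreal"
  assumes [measurable]: "f \<in> borel_measurable borel" "v \<in> borel_measurable borel"
    and "\<And>x. 0 \<le> f x" and t: "t < (\<integral>\<^sup>+x. v x * ennreal (f x) \<partial>lborel)"
  obtains I :: "real set" and A where "finite I" "disjoint_family_on A I"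
    "\<And>y. y \<in> I \<Longrightarrow> 0 < y" "\<And>y. y \<in> I \<Longrightarrow> A y \<in> sets borel" "\<And>y. y \<in> I \<Longrightarrow> bounded (A y)"
    "\<And>x y. y \<in> I \<Longrightarrow> x \<in> A y \<Longrightarrow> y \<le> f x"
    "t < (\<integral>\<^sup>+x. v x * (\<Sum>y\<in>I. ennreal y * indicator (A y) x) \<partial>lborel)"
proof -
  obtain s where s: "\<And>i. simple_function borel (s i)" "incseq s" "\<And>i x. s i x < top"
    "\<And>x. (SUP i. s i x) = ennreal (f x)"
    using borel_measurable_implies_simple_function_sequence'[of "\<lambda>x. ennreal (f x)" borel] by auto
  have [measurable]: "s i \<in> borel_measurable borel" for i
    using s(1) by (rule borel_measurable_simple_function)
  have [measurable]: "cball (0::'a) R \<in> sets borel" for R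
    by simp
  define h where "h = (\<lambda>i x. s i x * indicator (cball 0 (real i)) x)"
  have h_mono: "h i x \<le> h j x" if "i \<le> j" for i j x
    using s(2) that unfolding h_def incseq_def le_fun_def
    by (intro mult_mono) (auto simp: indicator_def)
  have h_SUP: "(SUP i. h i x) = ennreal (f x)" for x
  proof (rule antisym)
    show "(SUP i. h i x) \<le> ennreal (f x)"
      unfolding s(4)[symmetric] h_def by (intro SUP_mono) (auto simp: indicator_def)
    show "ennreal (f x) \<le> (SUP i. h i x)"
      unfolding s(4)[symmetric]
    proof (rule SUP_least)
      fix i
      obtain n where "norm x \<le> real n" using real_arch_simple by blast
      then have "s i x \<le> h (max i n) x"
        using s(2) by (auto simp: h_def incseq_def le_fun_def)
      also have "\<dots> \<le> (SUP i. h i x)" by (rule SUP_upper) simp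
      finally show "s i x \<le> (SUP i. h i x)" .
    qed
  qed
  have "(\<integral>\<^sup>+x. v x * ennreal (f x) \<partial>lborel) = (\<integral>\<^sup>+x. (SUP i. v x * h i x) \<partial>lborel)"
    unfolding h_SUP[symmetric] by (simp add: SUP_mult_left_ennreal)
  also have "\<dots> = (SUP i. \<integral>\<^sup>+x. v x * h i x \<partial>lborel)"
  proof (rule nn_integral_monotone_convergence_SUP)
    show "incseq (\<lambda>i x. v x * h i x)"
      by (auto simp: incseq_def le_fun_def intro!: mult_left_mono h_mono)
    show "(\<lambda>x. v x * h i x) \<in> borel_measurable lborel" for i
      unfolding h_def by measurable
  qed
  finally obtain i where i: "t < (\<integral>\<^sup>+x. v x * h i x \<partial>lborel)"
    using t by (auto simp: less_SUP_iff)
  define I where "I = enn2real ` range (s i) - {0}"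
  define A where "A = (\<lambda>y. {x \<in> cball 0 (real i). enn2real (s i x) = y})"
  have "finite (range (s i))" using s(1)[of i] by (auto simp: simple_function_def)
  then have fin: "finite I" by (simp add: I_def)
  have h_eq: "h i x = (\<Sum>y\<in>I. ennreal y * indicator (A y) x)" for x
  proof (cases "h i x = 0")
    case True
    then have "x \<notin> A y" if "y \<in> I" for y
      using that by (auto simp: h_def A_def I_def indicator_def)
    then have "(\<Sum>y\<in>I. ennreal y * indicator (A y) x) = 0"
      by (intro sum.neutral) auto
    with True show ?thesis by simp
  next
    case False
    then have x: "x \<in> cball 0 (real i)" "s i x \<noteq> 0" by (auto simp: h_def indicator_def split: if_splits)
    define y where "y = enn2real (s i x)"
    have y: "y \<in> I" "x \<in> A y" "ennreal y = s i x"
      using x s(3)[of i x] by (auto simp: I_def A_def y_def enn2real_eq_0_iff)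
    have "(\<Sum>z\<in>I. ennreal z * indicator (A z) x) = (\<Sum>z\<in>{y}. ennreal z * indicator (A z) x)"
      using fin y by (intro sum.mono_neutral_right) (auto simp: A_def y_def indicator_def)
    then show ?thesis using x y by (simp add: h_def)
  qed
  show thesis
  proof (rule that[of I A])
    show "finite I" by fact
    show "disjoint_family_on A I" by (auto simp: disjoint_family_on_def A_def)
    show "0 < y" if "y \<in> I" for y using that by (auto simp: I_def less_le)
    show "A y \<in> sets borel" if "y \<in> I" for y unfolding A_def by measurable
    show "bounded (A y)" if "y \<in> I" for y by (rule bounded_subset[of "cball 0 (real i)"]) (auto simp: A_def)
    show "y \<le> f x" if "y \<in> I" "x \<in> A y" for x y
    proof -
      have "s i x \<le> ennreal (f x)" unfolding s(4)[symmetric] by (rule SUP_upper) simp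
      then have "enn2real (s i x) \<le> f x" using assms(3) by (simp add: enn2real_leI)
      then show ?thesis using that by (simp add: A_def)
    qed
    show "t < (\<integral>\<^sup>+x. v x * (\<Sum>y\<in>I. ennreal y * indicator (A y) x) \<partial>lborel)"
      using i by (simp add: h_eq)
  qed
qed

context quantization
begin

section \<open>Volume asymptotics for bounded Borel sets\<close>

lemma measure_cube: "0 \<le> h \<Longrightarrow> measure lborel (cube t h) = h ^ DIM('a)"
  by (simp only: measure_def emeasure_cube) simp

lemma bounded_subset_cube:
  fixes A :: "'a set"
  assumes "bounded A"
  obtains t h where "0 < h" "A \<subseteq> cube t h" "measure lborel A < h ^ DIM('a)"
proof -
  obtain R where R: "0 < R" "\<And>x. x \<in> A \<Longrightarrow> norm x \<le> R"
    using assms bounded_pos by metis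
  have sub: "A \<subseteq> cube (- R' *\<^sub>R One) (2 * R')" if "R \<le> R'" for R'
  proof
    fix x assume "x \<in> A"
    have "\<bar>x \<bullet> b\<bar> \<le> R'" if "b \<in> Basis" for b
      using Basis_le_norm[OF that, of x] R(2)[OF \<open>x \<in> A\<close>] \<open>R \<le> R'\<close> by linarith
    then show "x \<in> cube (- R' *\<^sub>R One) (2 * R')" by (fastforce simp: mem_box inner_simps)
  qed
  show thesis
  proof
    \<comment> \<open>Twice the side that would contain A: the strict volume inequality leaves a
      complement of positive measure in \<open>lower_bounded_set\<close>.\<close>
    show "0 < 2 * (2 * R)" using R by simp
    show "A \<subseteq> cube (- (2 * R) *\<^sub>R One) (2 * (2 * R))" using R by (intro sub) auto
    have "measure lborel A \<le> measure lborel (cube (- R *\<^sub>R One :: 'a) (2 * R))"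
    proof (cases "A \<in> sets borel")
      case True
      then show ?thesis
        using sub[of R] emeasure_bounded_finite[OF bounded_cbox]
        by (intro measure_mono_fmeasurable) (auto simp: fmeasurable_def)
    next
      case False
      then show ?thesis by (simp add: measure_notin_sets)
    qed
    also have "\<dots> = (2 * R) ^ DIM('a)"
      using R by (intro measure_cube) simp
    also have "\<dots> < (2 * (2 * R)) ^ DIM('a)"
      using R by (intro power_strict_mono) auto
    finally show "measure lborel A < (2 * (2 * R)) ^ DIM('a)" .
  qed
qed

lemma bounded_borel_fmeasurable: "bounded A \<Longrightarrow> A \<in> sets borel \<Longrightarrow> A \<in> fmeasurable (lborel :: 'a measure)"
  using emeasure_bounded_finite[of A] by (auto simp: fmeasurable_def)

text \<open>On a bounded set the weight of \<open>upper_moment\<close> is bounded, so the error is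
  controlled by the measure alone. This handles what a finite family of cubes leaves
  uncovered.\<close>

lemma upper_small_set:
  fixes C :: "'a set"
  assumes "bounded C" "0 < e"
  obtains \<eta> where "0 < \<eta>"
    "\<And>B. B \<in> sets borel \<Longrightarrow> B \<subseteq> C \<Longrightarrow> measure lborel B \<le> \<eta> \<Longrightarrow> upper (indicator B) e"
proof -
  obtain K where K: "0 \<le> K" "\<And>g I. g \<in> borel_measurable borel \<Longrightarrow> 0 \<le> I \<Longrightarrow>
      (\<integral>\<^sup>+x. ennreal ((1 + norm x) powr (r + 1)) * g x \<partial>lborel) \<le> ennreal I \<Longrightarrow> upper g (K * I)"
    using upper_moment[of 1] by auto
  obtain R where R: "0 < R" "\<And>x. x \<in> C \<Longrightarrow> norm x \<le> R"
    using assms bounded_pos by metis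
  define W where "W = (1 + R) powr (r + 1)"
  have W: "0 < W" using R by (simp add: W_def)
  \<comment> \<open>K + 1 because K may be 0.\<close>
  define \<eta> where "\<eta> = e / ((K + 1) * W)"
  show thesis
  proof
    show "0 < \<eta>" using W K assms by (simp add: \<eta>_def)
    fix B :: "'a set" assume B: "B \<in> sets borel" "B \<subseteq> C" "measure lborel B \<le> \<eta>"
    have [measurable]: "B \<in> sets borel" by fact
    have "(1 + norm x) powr (r + 1) \<le> W" if "x \<in> B" for x
      unfolding W_def using R(2)[of x] that B(2) r_pos by (intro powr_mono2) auto
    then have "(\<integral>\<^sup>+x. ennreal ((1 + norm x) powr (r + 1)) * indicator B x \<partial>lborel)
        \<le> (\<integral>\<^sup>+x. ennreal W * indicator B x \<partial>lborel)"
      by (intro nn_integral_mono) (auto simp: indicator_def intro: ennreal_leI)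
    also have "\<dots> = ennreal W * emeasure lborel B"
      by (subst nn_integral_cmult_indicator) auto
    also have "emeasure lborel B = ennreal (measure lborel B)"
      using bounded_borel_fmeasurable[of B] B assms(1) by (auto simp: emeasure_eq_measure2 bounded_subset)
    also have "ennreal W * ennreal (measure lborel B) \<le> ennreal (W * \<eta>)"
      using W B by (subst ennreal_mult[symmetric]) (auto intro!: ennreal_leI mult_left_mono)
    finally have "upper (indicator B) (K * (W * \<eta>))"
      using W \<open>0 < \<eta>\<close> by (intro K(2)) auto
    moreover have "K * (W * \<eta>) \<le> e"
    proof -
      have "K * (W * \<eta>) = K * e / (K + 1)" using W by (simp add: \<eta>_def)
      also have "\<dots> \<le> e" using K(1) assms(2) by (simp add: field_simps)
      finally show ?thesis .
    qed
    ultimately show "upper (indicator B) e" by (auto intro: upper_mono)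
  qed
qed

text \<open>Cover A by nonoverlapping cubes of total volume at most |A| + \<epsilon>/2, keep
  finitely many, and let the uncovered part of A count as another \<epsilon>/2. By additivity the
  total is |A| + \<epsilon>.\<close>

lemma upper_bounded_set:
  fixes A :: "'a set"
  assumes "bounded A" and [measurable]: "A \<in> sets borel"
  shows "upper (indicator A) (quantization_const * measure lborel A powr (1 + rate))"
proof (rule upper_powr_limit)
  fix \<epsilon> :: real assume \<epsilon>: "0 < \<epsilon>"
  obtain t h where h: "0 < h" "A \<subseteq> cube t h" using bounded_subset_cube[OF assms(1)] by metis
  \<comment> \<open>The tolerance is fixed before the cover: a remainder of measure at most \<eta>
    is as cheap as a set of volume \<epsilon>/2.\<close>
  obtain \<eta> where \<eta>: "0 < \<eta>"
    "\<And>B. B \<in> sets borel \<Longrightarrow> B \<subseteq> cube t h \<Longrightarrow> measure lborel B \<le> \<eta> \<Longrightarrow>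
      upper (indicator B) (quantization_const * (\<epsilon> / 2) powr (1 + rate))"
    using upper_small_set[of "cube t h" "quantization_const * (\<epsilon> / 2) powr (1 + rate)"]
      quantization_const_pos \<epsilon> by auto
  have box: "box t (t + h *\<^sub>R One) \<noteq> {}" using h by (auto simp: box_ne_empty inner_simps)
  have "A \<in> lmeasurable"
    using bounded_borel_fmeasurable[OF assms] by (auto simp: fmeasurable_def)
  from measurable_outer_intervals_bounded[OF this h(2), of "\<epsilon> / 2"] \<epsilon>
  obtain D where D: "countable D"
    "\<And>K. K \<in> D \<Longrightarrow> K \<subseteq> cube t h \<and> K \<noteq> {} \<and> (\<exists>c d. K = cbox c d)"
    "pairwise (\<lambda>A B. interior A \<inter> interior B = {}) D"
    "\<And>u v. cbox u v \<in> D \<Longrightarrow> \<exists>n. \<forall>i\<in>Basis. v \<bullet> i - u \<bullet> i = ((t + h *\<^sub>R One) \<bullet> i - t \<bullet> i) / 2 ^ n"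
    "\<And>K. \<lbrakk>K \<in> D; box t (t + h *\<^sub>R One) \<noteq> {}\<rbrakk> \<Longrightarrow> interior K \<noteq> {}"
    "A \<subseteq> \<Union>D" "\<Union>D \<in> lmeasurable" "measure lebesgue (\<Union>D) \<le> measure lebesgue A + \<epsilon> / 2"
    by (metis half_gt_zero)
  have Dm: "K \<in> lmeasurable" if "K \<in> D" for K using D(2)[OF that] by auto
  obtain F where F: "F \<subseteq> D" "finite F" "measure lebesgue (\<Union>D) - \<eta> < measure lebesgue (\<Union>F)"
  proof (rule measure_countable_Union_approachable[OF D(1) \<eta>(1), of "measure lebesgue (\<Union>D)"])
    show "measure lebesgue (\<Union>D') \<le> measure lebesgue (\<Union>D)" if "D' \<subseteq> D" "finite D'" for D'
      using that D(7) Dm by (intro measure_mono_fmeasurable) (auto intro!: sets.finite_Union dest!: Dm simp: fmeasurableD)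
  qed (use Dm in auto)
  have Fm: "\<Union>F \<in> lmeasurable" using F Dm by (intro fmeasurable.finite_Union) auto
  \<comment> \<open>The covering boxes are dyadic parts of the cube \<open>cube t h\<close>, so all
    their sides are equal.\<close>
  have "\<exists>c s. 0 < s \<and> K = cube c s" if "K \<in> F" for K
  proof -
    from that F D(2) obtain c d where K: "K = cbox c d" by blast
    with D(4)[of c d] that F obtain n where n: "\<And>i. i \<in> Basis \<Longrightarrow> d \<bullet> i - c \<bullet> i = h / 2 ^ n"
      by (auto simp: inner_simps)
    have "d \<bullet> i = c \<bullet> i + h / 2 ^ n" if "i \<in> Basis" for i
      using n[OF that] by simp
    then have "d = c + (h / 2 ^ n) *\<^sub>R One"
      by (subst euclidean_eq_iff) (simp add: inner_simps)
    then show ?thesis using h K by (intro exI[of _ c] exI[of _ "h / 2 ^ n"]) auto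
  qed
  then obtain c side where cs: "\<And>K. K \<in> F \<Longrightarrow> 0 < side K \<and> K = cube (c K) (side K)" by metis
  have side: "0 < side K" if "K \<in> F" for K using cs[OF that] by blast
  have vol: "measure lebesgue K = side K ^ DIM('a)" if "K \<in> F" for K
  proof -
    from cs[OF that] obtain c s where K: "K = cube c s" "s = side K" "0 < s" by blast
    show ?thesis unfolding K(2)[symmetric] using K(3) measure_cube[of s c] by (simp add: K(1))
  qed
  \<comment> \<open>A convex set without interior is negligible, so the volumes of the cubes add
    up.\<close>
  have "pairwise (\<lambda>S T. negligible (S \<inter> T)) F"
  proof (rule pairwiseI)
    fix S T assume ST: "S \<in> F" "T \<in> F" "S \<noteq> T"
    then have "interior (S \<inter> T) = {}" using D(3) F(1) by (auto simp: pairwise_def)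
    moreover have "convex (S \<inter> T)" using cs[OF ST(1)] cs[OF ST(2)] by (metis convex_Int convex_box(1))
    ultimately show "negligible (S \<inter> T)" by (simp add: negligible_convex_interior)
  qed
  then have sum: "(\<Sum>K\<in>F. side K ^ DIM('a)) = measure lebesgue (\<Union>F)"
    using F Dm by (subst measure_negligible_finite_Union) (auto simp: vol)
  define B where "B = A - \<Union>F"
  have [measurable]: "\<Union>F \<in> sets borel"
  proof (rule sets.finite_Union[OF F(2)], rule subsetI)
    fix K assume "K \<in> F"
    with F(1) D(2) obtain c d where "K = cbox c d" by blast
    then show "K \<in> sets borel" by simp
  qed
  have [measurable]: "B \<in> sets borel" by (simp add: B_def)
  have "measure lborel B = measure lebesgue B" by simp
  also have "\<dots> \<le> measure lebesgue (\<Union>D - \<Union>F)"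
    using D(6,7) Fm by (intro measure_mono_fmeasurable) (auto simp: B_def fmeasurable.Diff)
  also have "\<dots> = measure lebesgue (\<Union>D) - measure lebesgue (\<Union>F)"
    using D(7) Fm F(1) by (intro measurable_measure_Diff) (auto simp: fmeasurableD)
  finally have "measure lborel B \<le> \<eta>" using F(3) by simp
  then have "upper (indicator B) (quantization_const * (\<epsilon> / 2) powr (1 + rate))"
    using h by (intro \<eta>(2)) (auto simp: B_def)
  moreover have "upper (\<lambda>x. \<Sum>K\<in>F. indicator (cube (c K) (side K)) x)
      (quantization_const * (\<Sum>K\<in>F. side K ^ DIM('a)) powr (1 + rate))"
    using F(2) side quantization_const_pos
    by (intro upper_sum upper_cube) (auto intro: less_imp_le)
  moreover have "0 \<le> (\<Sum>K\<in>F. side K ^ DIM('a))"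
    using side by (intro sum_nonneg zero_le_power) (auto intro: less_imp_le)
  ultimately have "upper (\<lambda>x. (\<Sum>K\<in>F. indicator (cube (c K) (side K)) x) + indicator B x)
      (quantization_const * ((\<Sum>K\<in>F. side K ^ DIM('a)) + \<epsilon> / 2) powr (1 + rate))"
    using \<epsilon> quantization_const_pos by (intro upper_add borel_measurable_sum) auto
  then show "upper (indicator A) (quantization_const * (measure lborel A + \<epsilon>) powr (1 + rate))"
  proof (rule upper_mono)
    show "indicator A x \<le> (\<Sum>K\<in>F. indicator (cube (c K) (side K)) x) + (indicator B x :: ennreal)" for x
    proof (cases "x \<in> \<Union>F")
      case True
      then obtain K where K: "K \<in> F" "x \<in> K" by blast
      have "(1::ennreal) = (\<Sum>K\<in>{K}. indicator (cube (c K) (side K)) x)"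
        using K cs[OF K(1)] by simp
      also have "\<dots> \<le> (\<Sum>K\<in>F. indicator (cube (c K) (side K)) x)"
        using F(2) K(1) by (intro sum_mono2) auto
      finally have "1 \<le> (\<Sum>K\<in>F. indicator (cube (c K) (side K)) x) + (indicator B x :: ennreal)"
        by (rule add_increasing2[rotated]) simp
      then show ?thesis by (rule order_trans[rotated]) (simp add: indicator_def)
    qed (auto simp: B_def indicator_def)
    have "measure lebesgue (\<Union>F) \<le> measure lebesgue (\<Union>D)"
      using D(7) Fm F(1) by (intro measure_mono_fmeasurable) (auto simp: fmeasurableD)
    then show "quantization_const * ((\<Sum>K\<in>F. side K ^ DIM('a)) + \<epsilon> / 2) powr (1 + rate)
      \<le> quantization_const * (measure lborel A + \<epsilon>) powr (1 + rate)"
      using D(8) quantization_const_pos rate_pos \<epsilon> unfolding sum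
      by (intro mult_left_mono powr_mono2) (auto intro: add_nonneg_pos)
  qed
qed simp

text \<open>The complement \<open>C - A\<close> in a cube \<open>C\<close> cannot be quantized worse than \<open>upper_bounded_set\<close>
  allows; if \<open>A\<close> could be quantized better, then so could \<open>C\<close>.\<close>

lemma lower_bounded_set:
  fixes A :: "'a set"
  assumes "bounded A" and [measurable]: "A \<in> sets borel"
  shows "lower (indicator A) (quantization_const * measure lborel A powr (1 + rate))"
proof (cases "measure lborel A = 0")
  case True
  then show ?thesis by (auto simp: lower_def ennreal_neg mult_nonpos_nonneg)
next
  case False
  let ?Q = quantization_const
  define a where "a = measure lborel A"
  have a: "0 < a" using False by (simp add: a_def less_le)
  obtain t h where h: "0 < h" "A \<subseteq> cube t h" "a < h ^ DIM('a)"
    unfolding a_def using bounded_subset_cube[OF assms(1)] by metis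
  define V where "V = h ^ DIM('a)"
  \<comment> \<open>The complement receives \<xi> m points when A has m, the optimal ratio a : V -
    a. Any other ratio would lose a factor.\<close>
  define \<xi> where "\<xi> = (V - a) / a"
  have \<xi>: "0 < \<xi>" "1 + \<xi> = V / a" and V: "0 < V - a" "0 < V"
    using a h by (auto simp: \<xi>_def V_def field_simps)
  define B where "B = cube t h - A"
  have [measurable]: "B \<in> sets borel" and "bounded B"
    by (auto simp: B_def intro: bounded_subset[of "cube t h"])
  have "measure lborel B = V - a"
    unfolding B_def V_def a_def
    using h bounded_borel_fmeasurable[of "cube t h"] bounded_borel_fmeasurable[OF assms]
    by (subst measurable_measure_Diff) (auto simp: measure_cube fmeasurableD)
  with upper_bounded_set[OF \<open>bounded B\<close>] have upB: "upper (indicator B) (?Q * (V - a) powr (1 + rate))"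
    by simp
  \<comment> \<open>At this ratio both bounds become linear in the volume, and their difference is
    exactly Q a^(1+rate).\<close>
  have VQ: "?Q * V powr (1 + rate) * (V / a) powr - rate = ?Q * V * a powr rate"
    using V a by (simp add: powr_add powr_divide powr_minus field_simps)
  have BQ: "?Q * (V - a) powr (1 + rate) * \<xi> powr - rate = ?Q * (V - a) * a powr rate"
    using V a by (simp add: \<xi>_def powr_add powr_divide powr_minus field_simps)
  show ?thesis
    unfolding lower_def a_def[symmetric]
  proof (intro allI impI)
    fix c assume "c < ?Q * a powr (1 + rate)"
    then have "?Q * (V - a) powr (1 + rate) * \<xi> powr - rate < ?Q * V * a powr rate - c"
      unfolding BQ using a by (simp add: powr_add algebra_simps)
    moreover define k where "k = (\<lambda>m::nat. nat \<lfloor>\<xi> * real m\<rfloor>)"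
    moreover have "filterlim k at_top sequentially" "(\<lambda>m. real (k m) / real m) \<longlonglongrightarrow> \<xi>"
      unfolding k_def using \<xi>(1) by real_asymp+
    ultimately have "\<forall>\<^sub>F m in sequentially. qerr (k m) (indicator B) \<le> ennreal ((?Q * V * a powr rate - c) * real m powr - rate)"
      using \<xi> V quantization_const_pos upB by (intro upper_fraction) auto
    then show "\<forall>\<^sub>F m in sequentially. ennreal (c * real m powr - rate) \<le> qerr m (indicator A)"
      using eventually_gt_at_top[of 0]
    proof eventually_elim
      case (elim m)
      let ?x = "real m powr - rate"
      have "real (k m) \<le> \<xi> * real m" using \<xi>(1) by (simp add: k_def)
      then have "real (m + k m) \<le> (1 + \<xi>) * real m" by (simp add: distrib_right)
      then have "((V / a) * real m) powr - rate \<le> real (m + k m) powr - rate"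
        unfolding \<xi>(2) using elim(2) rate_pos by (intro powr_mono2') auto
      then have "?Q * V powr (1 + rate) * ((V / a) * real m) powr - rate \<le> ?Q * V powr (1 + rate) * real (m + k m) powr - rate"
        using quantization_const_pos by (intro mult_left_mono) auto
      also have "?Q * V powr (1 + rate) * ((V / a) * real m) powr - rate = ?Q * V * a powr rate * ?x"
        using V a by (simp only: powr_mult mult.assoc[symmetric] VQ)
      finally have "ennreal (?Q * V * a powr rate * ?x) \<le> ennreal (?Q * V powr (1 + rate) * real (m + k m) powr - rate)"
        by (rule ennreal_leI)
      also have "\<dots> \<le> qerr (m + k m) (indicator (cube t h))"
        unfolding V_def using elim(2) h by (intro qerr_cube_ge) auto
      also have "\<dots> \<le> qerr (m + k m) (\<lambda>x. indicator A x + indicator B x)"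
        by (intro qerr_mono) (auto simp: indicator_def B_def)
      also have "\<dots> \<le> qerr m (indicator A) + qerr (k m) (indicator B)"
        by (rule qerr_subadditive) auto
      also have "\<dots> \<le> qerr m (indicator A) + ennreal ((?Q * V * a powr rate - c) * ?x)"
        using elim(1) by (rule add_left_mono)
      finally have *: "ennreal (?Q * V * a powr rate * ?x) \<le> qerr m (indicator A) + ennreal ((?Q * V * a powr rate - c) * ?x)" .
      show ?case
      proof (cases "qerr m (indicator A)")
        case (real b)
        have pos: "0 \<le> ?Q * V * a powr rate - c"
        proof -
          have "0 \<le> ?Q * (V - a) powr (1 + rate) * \<xi> powr - rate"
            using quantization_const_pos by simp
          then show ?thesis
            using \<open>?Q * (V - a) powr (1 + rate) * \<xi> powr - rate < ?Q * V * a powr rate - c\<close> by linarith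
        qed
        then have "ennreal (?Q * V * a powr rate * ?x) \<le> ennreal (b + (?Q * V * a powr rate - c) * ?x)"
          using * real by (subst ennreal_plus) auto
        then have "?Q * V * a powr rate * ?x \<le> b + (?Q * V * a powr rate - c) * ?x"
          using real pos by (subst (asm) ennreal_le_iff) auto
        then have "c * ?x \<le> b" by (simp add: algebra_simps)
        then show ?thesis using real by (auto intro: ennreal_leI)
      qed simp
    qed
  qed
qed

lemma distortion_sum:
  assumes "\<And>i. i \<in> I \<Longrightarrow> g i \<in> borel_measurable borel"
  shows "distortion Z (\<lambda>x. \<Sum>i\<in>I. g i x) = (\<Sum>i\<in>I. distortion Z (g i))"
proof -
  have [measurable]: "g i \<in> borel_measurable lborel" if "i \<in> I" for i using assms[OF that] by simp
  show ?thesis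
    unfolding distortion_def sum_distrib_left by (rule nn_integral_sum) measurable
qed

text \<open>Adding a fixed finite \<open>\<eta>\<close>-net \<open>W\<close> of \<open>\<Union>i. A i\<close> to \<open>Z\<close> forces each \<open>x \<in> A i\<close> to be served
  by a point within \<open>\<eta>\<close> of \<open>A i\<close>, so different \<open>A i\<close> use disjoint sets of points.\<close>

lemma lower_disjoint_compact:
  fixes A :: "'i \<Rightarrow> 'a set"
  assumes I: "finite I" "I \<noteq> {}" and comp: "\<And>i. i \<in> I \<Longrightarrow> compact (A i)" and disj: "disjoint_family_on A I"
    and y: "\<And>i. i \<in> I \<Longrightarrow> 0 < y i"
  shows "lower (\<lambda>x. \<Sum>i\<in>I. ennreal (y i) * indicator (A i) x)
    (quantization_const * (\<Sum>i\<in>I. y i powr (1 / (1 + rate)) * measure lborel (A i)) powr (1 + rate))"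
  unfolding lower_def
proof (intro allI impI)
  let ?Q = quantization_const
  define N where "N = (\<lambda>i. y i powr (1 / (1 + rate)) * measure lborel (A i))"
  define S where "S = (\<Sum>i\<in>I. N i)"
  have [measurable]: "A i \<in> sets borel" if "i \<in> I" for i using comp[OF that] by (rule borel_compact)
  have N_powr: "N i powr (1 + rate) = y i * measure lborel (A i) powr (1 + rate)" if "i \<in> I" for i
    using y[OF that] rate_pos by (simp add: N_def powr_mult powr_powr)
  have N0: "0 \<le> N i" for i by (simp add: N_def)
  fix c assume "c < ?Q * (\<Sum>i\<in>I. y i powr (1 / (1 + rate)) * measure lborel (A i)) powr (1 + rate)"
  then have c: "c < ?Q * S powr (1 + rate)" by (simp add: S_def N_def)
  \<comment> \<open>The factor \<beta> < 1 turns the asymptotic bounds into inequalities valid from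
    a common index \<open>K0\<close> on, for all i at once.\<close>
  obtain \<beta> where \<beta>: "0 < \<beta>" "\<beta> < 1" "c < \<beta> * ?Q * S powr (1 + rate)"
  proof -
    let ?L = "?Q * S powr (1 + rate)"
    have "((\<lambda>b. b * ?L) \<longlongrightarrow> 1 * ?L) (at_left 1)" by (intro tendsto_intros)
    then have "\<forall>\<^sub>F b in at_left 1. c < b * ?L" using c by (intro order_tendstoD) auto
    moreover have "\<forall>\<^sub>F b in at_left (1::real). b \<in> {0<..<1}" by (rule eventually_at_left_real) simp
    ultimately have "\<forall>\<^sub>F b in at_left 1. b \<in> {0<..<1} \<and> c < b * ?L" by eventually_elim simp
    then obtain b where "b \<in> {0<..<1}" "c < b * ?L"
      using eventually_happens'[of "at_left (1::real)"] by (auto simp: trivial_limit_at_left_real)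
    then show ?thesis using that[of b] by (simp add: mult.assoc)
  qed
  have "\<forall>\<^sub>F m in sequentially. \<forall>i\<in>I. ennreal (\<beta> * ?Q * measure lborel (A i) powr (1 + rate) * real m powr - rate) \<le> qerr m (indicator (A i))"
  proof (rule eventually_ball_finite[OF I(1)], rule ballI)
    fix i assume i: "i \<in> I"
    let ?b = "?Q * measure lborel (A i) powr (1 + rate)"
    show "\<forall>\<^sub>F m in sequentially. ennreal (\<beta> * ?Q * measure lborel (A i) powr (1 + rate) * real m powr - rate) \<le> qerr m (indicator (A i))"
    proof (cases "measure lborel (A i) = 0")
      case False
      then have "0 < ?b" using quantization_const_pos by simp
      then have "\<beta> * ?b < ?b" using \<beta>(2) mult_strict_right_mono[of \<beta> 1 ?b] by simp
      moreover have "lower (indicator (A i)) ?b"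
        using comp[OF i] by (intro lower_bounded_set compact_imp_bounded borel_compact)
      ultimately show ?thesis
        unfolding lower_def mult.assoc[symmetric] by blast
    qed simp
  qed
  then obtain K0 where K0: "\<And>m i. K0 \<le> m \<Longrightarrow> i \<in> I \<Longrightarrow>
      ennreal (\<beta> * ?Q * measure lborel (A i) powr (1 + rate) * real m powr - rate) \<le> qerr m (indicator (A i))"
    by (auto simp: eventually_sequentially)
  \<comment> \<open>Each A i is credited with K extra points, so that its count is positive and at
    least \<open>K0\<close> even if Z puts few points near it.\<close>
  define K where "K = Suc K0"
  obtain \<eta> where \<eta>: "0 < \<eta>"
    "\<And>i j x y. i \<in> I \<Longrightarrow> j \<in> I \<Longrightarrow> i \<noteq> j \<Longrightarrow> x \<in> A i \<Longrightarrow> y \<in> A j \<Longrightarrow> \<eta> \<le> dist x y"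
    using disjoint_compact_family_separated[OF I(1) comp disj] by blast
  have "compact (\<Union>i\<in>I. A i)" using I comp by (intro compact_UN) auto
  then have "seq_compact (\<Union>i\<in>I. A i)" by (rule compact_imp_seq_compact)
  \<comment> \<open>Radius \<eta>/2, since a point within \<eta>/2 of both A i and A j would bring
    them closer than \<eta>.\<close>
  then obtain W0 where W0: "finite W0" "(\<Union>i\<in>I. A i) \<subseteq> (\<Union>w\<in>W0. ball w (\<eta> / 2))"
    using seq_compact_imp_totally_bounded \<eta>(1) by (metis half_gt_zero)
  define M where "M = card W0 + card I * K"
  have bound: "ennreal (\<beta> * ?Q * S powr (1 + rate) * real (m + M) powr - rate) \<le> qerr m (\<lambda>x. \<Sum>i\<in>I. ennreal (y i) * indicator (A i) x)" for m
  proof (rule qerr_greatest)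
    fix Z :: "'a set" assume Z: "finite Z" "Z \<noteq> {}" "card Z \<le> m"
    define Y where "Y = Z \<union> W0"
    have Y: "finite Y" "Y \<noteq> {}" using Z W0 by (auto simp: Y_def)
    define P where "P = (\<lambda>i. {z\<in>Y. \<exists>x\<in>A i. dist x z < \<eta> / 2})"
    have finP: "finite (P i)" for i using Y by (simp add: P_def)
    define k where "k = (\<lambda>i. card (P i) + K)"
    have "disjoint_family_on P I"
      unfolding disjoint_family_on_def
    proof (intro ballI impI)
      fix i j assume ij: "i \<in> I" "j \<in> I" "i \<noteq> j"
      have False if "z \<in> P i" "z \<in> P j" for z
      proof -
        from that obtain u v where uv: "u \<in> A i" "v \<in> A j" "dist u z < \<eta> / 2" "dist v z < \<eta> / 2"
          by (auto simp: P_def)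
        have "dist u v < \<eta>"
          using dist_triangle[of u v z] uv(3,4) by (simp add: dist_commute)
        with \<eta>(2)[OF ij uv(1,2)] show False by simp
      qed
      then show "P i \<inter> P j = {}" by blast
    qed
    then have "(\<Sum>i\<in>I. card (P i)) = card (\<Union>i\<in>I. P i)"
      using I finP by (subst card_UN_disjoint) (auto simp: disjoint_family_on_def)
    also have "\<dots> \<le> card Y" using Y by (intro card_mono) (auto simp: P_def)
    also have "\<dots> \<le> m + card W0" using card_Un_le[of Z W0] Z by (simp add: Y_def)
    finally have sumk: "(\<Sum>i\<in>I. k i) \<le> m + M" by (simp add: k_def M_def sum.distrib)
    have "ennreal (\<beta> * ?Q * S powr (1 + rate) * real (m + M) powr - rate)
        \<le> ennreal (\<beta> * ?Q * (S powr (1 + rate) * (\<Sum>i\<in>I. real (k i)) powr - rate))"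
    proof (intro ennreal_leI)
      have "0 < (\<Sum>i\<in>I. real (k i))" using I by (intro sum_pos) (auto simp: k_def K_def)
      moreover have "(\<Sum>i\<in>I. real (k i)) \<le> real (m + M)" using sumk by (simp flip: of_nat_sum)
      ultimately have "real (m + M) powr - rate \<le> (\<Sum>i\<in>I. real (k i)) powr - rate"
        using rate_pos by (intro powr_mono2') auto
      then show "\<beta> * ?Q * S powr (1 + rate) * real (m + M) powr - rate \<le> \<beta> * ?Q * (S powr (1 + rate) * (\<Sum>i\<in>I. real (k i)) powr - rate)"
        using \<beta> quantization_const_pos by (auto simp: mult.assoc intro!: mult_left_mono)
    qed
    also have "\<dots> \<le> ennreal (\<beta> * ?Q * (\<Sum>i\<in>I. N i powr (1 + rate) * real (k i) powr - rate))"
      unfolding S_def using I N0 rate_pos \<beta> quantization_const_pos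
      by (intro ennreal_leI mult_left_mono sum_powr_ge) (auto simp: k_def K_def)
    also have "\<dots> = (\<Sum>i\<in>I. ennreal (y i) * ennreal (\<beta> * ?Q * measure lborel (A i) powr (1 + rate) * real (k i) powr - rate))"
      unfolding sum_distrib_left
      using \<beta> quantization_const_pos y
      by (subst sum_ennreal[symmetric]) (auto intro!: sum.cong simp: N_powr ennreal_mult[symmetric] less_imp_le mult_ac)
    also have "\<dots> \<le> (\<Sum>i\<in>I. ennreal (y i) * distortion Z (indicator (A i)))"
    proof (intro sum_mono mult_left_mono)
      fix i assume i: "i \<in> I"
      show "ennreal (\<beta> * ?Q * measure lborel (A i) powr (1 + rate) * real (k i) powr - rate) \<le> distortion Z (indicator (A i))"
      proof (cases "A i = {}")
        case False
        have near: "infdist x (P i) \<le> infdist x Z \<and> P i \<noteq> {}" if x: "x \<in> A i" for x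
        proof -
          obtain z where z: "z \<in> Y" "infdist x Y = dist x z"
            using infdist_attains_inf[of Y x] Y by (auto simp: finite_imp_closed)
          obtain w where w: "w \<in> W0" "x \<in> ball w (\<eta> / 2)" using W0(2) i x by blast
          have "dist x z \<le> dist x w" unfolding z(2)[symmetric] using w by (intro infdist_le) (simp add: Y_def)
          also have "\<dots> < \<eta> / 2" using w by (simp add: dist_commute)
          finally have "z \<in> P i" using z x by (auto simp: P_def)
          then have "infdist x (P i) \<le> infdist x Y" unfolding z(2) by (rule infdist_le)
          also have "\<dots> \<le> infdist x Z" using Z by (intro infdist_mono) (auto simp: Y_def)
          finally show ?thesis using \<open>z \<in> P i\<close> by auto
        qed
        have "ennreal (\<beta> * ?Q * measure lborel (A i) powr (1 + rate) * real (k i) powr - rate) \<le> qerr (k i) (indicator (A i))"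
          using i by (intro K0) (auto simp: k_def K_def)
        also have "\<dots> \<le> distortion (P i) (indicator (A i))"
          using near False finP by (intro qerr_le) (auto simp: k_def)
        also have "\<dots> \<le> distortion Z (indicator (A i))"
          unfolding distortion_def using near r_pos
          by (intro nn_integral_mono) (auto simp: indicator_def infdist_nonneg intro!: ennreal_leI powr_mono2)
        finally show ?thesis .
      qed (simp add: rate_pos)
    qed simp
    also have "\<dots> = distortion Z (\<lambda>x. \<Sum>i\<in>I. ennreal (y i) * indicator (A i) x)"
      by (subst distortion_sum) (auto simp: distortion_cmult)
    finally show "ennreal (\<beta> * ?Q * S powr (1 + rate) * real (m + M) powr - rate) \<le> distortion Z (\<lambda>x. \<Sum>i\<in>I. ennreal (y i) * indicator (A i) x)" .
  qed
  \<comment> \<open>The number M of added points does not depend on m, so it disappears in the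
    limit.\<close>
  have "(\<lambda>m. real (m + M) / real m) \<longlonglongrightarrow> 1" by real_asymp
  from fraction_powr_tendsto[OF this, of "\<beta> * ?Q * S powr (1 + rate)"]
  have "(\<lambda>m. \<beta> * ?Q * S powr (1 + rate) * (real (m + M) / real m) powr - rate) \<longlonglongrightarrow> \<beta> * ?Q * S powr (1 + rate)"
    by simp
  then have "\<forall>\<^sub>F m in sequentially. c < \<beta> * ?Q * S powr (1 + rate) * (real (m + M) / real m) powr - rate"
    using \<beta>(3) by (intro order_tendstoD) auto
  then show "\<forall>\<^sub>F m in sequentially. ennreal (c * real m powr - rate) \<le> qerr m (\<lambda>x. \<Sum>i\<in>I. ennreal (y i) * indicator (A i) x)"
    using eventually_gt_at_top[of 0]
  proof eventually_elim
    case (elim m)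
    have "c * real m powr - rate \<le> \<beta> * ?Q * S powr (1 + rate) * (real (m + M) / real m) powr - rate * real m powr - rate"
      using elim by (intro mult_right_mono) auto
    also have "\<dots> = \<beta> * ?Q * S powr (1 + rate) * real (m + M) powr - rate"
      using powr_fraction[OF elim(2), of "m + M"] by simp
    finally show ?case using bound[of m] by (auto intro: order_trans ennreal_leI)
  qed
qed

end

subsection \<open>Densities\<close>

lemma disjoint_sum_indicator_le:
  fixes c :: "'i \<Rightarrow> ennreal"
  assumes "finite I" "disjoint_family_on A I" "\<And>i. i \<in> I \<Longrightarrow> x \<in> A i \<Longrightarrow> c i \<le> b"
  shows "(\<Sum>i\<in>I. c i * indicator (A i) x) \<le> b"
proof (cases "\<exists>i\<in>I. x \<in> A i")
  case True
  then obtain i where i: "i \<in> I" "x \<in> A i" by blast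
  have "(\<Sum>j\<in>I. c j * indicator (A j) x) = (\<Sum>j\<in>{i}. c j * indicator (A j) x)"
    using assms(1,2) i by (intro sum.mono_neutral_right) (auto simp: disjoint_family_on_def indicator_def)
  then show ?thesis using assms(3)[OF i] i by simp
next
  case False
  then have "(\<Sum>j\<in>I. c j * indicator (A j) x) = 0"
    by (intro sum.neutral) (auto simp: indicator_def)
  then show ?thesis by simp
qed

context quantization
begin

text \<open>The additive quantity is linear in f^(1/(1+rate)), so this power is approximated from
  below and the levels are raised to 1 + rate afterwards. Inner regularity makes the level sets
  compact. Only N strictly below the integral is asked for, so an infinite integral is
  covered.\<close>

lemma lower_density:
  fixes f :: "'a \<Rightarrow> real"
  assumes [measurable]: "f \<in> borel_measurable borel" and f0: "\<And>x. 0 \<le> f x" and "0 \<le> N"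
    and N: "ennreal N < (\<integral>\<^sup>+x. ennreal (f x powr (1 / (1 + rate))) \<partial>lborel)"
  shows "lower (\<lambda>x. ennreal (f x)) (quantization_const * N powr (1 + rate))"
proof -
  let ?p = "1 / (1 + rate)"
  have "ennreal N < (\<integral>\<^sup>+x. 1 * ennreal (f x powr ?p) \<partial>lborel)" using N by simp
  then obtain I :: "real set" and A where IA: "finite I" "disjoint_family_on A I"
    "\<And>y. y \<in> I \<Longrightarrow> 0 < y" "\<And>y. y \<in> I \<Longrightarrow> A y \<in> sets borel" "\<And>y. y \<in> I \<Longrightarrow> bounded (A y)"
    "\<And>x y. y \<in> I \<Longrightarrow> x \<in> A y \<Longrightarrow> y \<le> f x powr ?p"
    and less: "ennreal N < (\<integral>\<^sup>+x. 1 * (\<Sum>y\<in>I. ennreal y * indicator (A y) x) \<partial>lborel)"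
    by (rule simple_approximation_from_below[rotated 3]) auto
  have "(\<integral>\<^sup>+x. 1 * (\<Sum>y\<in>I. ennreal y * indicator (A y) x) \<partial>lborel) = (\<Sum>y\<in>I. ennreal y * emeasure lborel (A y))"
    using IA(4) by (simp add: nn_integral_sum nn_integral_cmult_indicator)
  also have "\<dots> = (\<Sum>y\<in>I. ennreal (y * measure lborel (A y)))"
  proof (rule sum.cong[OF refl])
    fix y assume y: "y \<in> I"
    have "emeasure lborel (A y) = ennreal (measure lborel (A y))"
      using bounded_borel_fmeasurable[OF IA(5,4)[OF y]] by (rule emeasure_eq_measure2)
    then show "ennreal y * emeasure lborel (A y) = ennreal (y * measure lborel (A y))"
      using IA(3)[OF y] by (simp add: ennreal_mult)
  qed
  also have "\<dots> = ennreal (\<Sum>y\<in>I. y * measure lborel (A y))"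
    using IA(3) by (intro sum_ennreal) (simp add: less_imp_le)
  finally have N_less: "N < (\<Sum>y\<in>I. y * measure lborel (A y))"
    using less \<open>0 \<le> N\<close> by (simp add: ennreal_less_iff)
  \<comment> \<open>A loss of e in the measure of every level set costs e times the sum of the
    levels, which stays within the gap above N.\<close>
  define e where "e = ((\<Sum>y\<in>I. y * measure lborel (A y)) - N) / (1 + \<Sum>I)"
  have I0: "0 \<le> \<Sum>I" using IA(3) by (intro sum_nonneg) (auto intro: less_imp_le)
  have e: "0 < e" using N_less I0 by (simp add: e_def)
  have "\<exists>C. compact C \<and> C \<subseteq> A y \<and> measure lborel (A y) - e \<le> measure lborel C" if y: "y \<in> I" for y
  proof -
    have Am: "A y \<in> lmeasurable"
      using bounded_borel_fmeasurable[OF IA(5,4)[OF y]] by (auto simp: fmeasurable_def)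
    then obtain C where C: "closed C" "C \<subseteq> A y" "A y - C \<in> lmeasurable" "emeasure lebesgue (A y - C) < ennreal e"
      using sets_lebesgue_inner_closed[OF fmeasurableD[OF Am] e] by blast
    have "compact C" using C IA(5)[OF y] by (simp add: compact_eq_bounded_closed bounded_subset)
    then have Cm: "C \<in> lmeasurable" by (rule lmeasurable_compact)
    have "measure lebesgue (A y - C) < e"
      using C(3,4) e by (simp add: emeasure_eq_measure2 ennreal_less_iff)
    then have "measure lebesgue (A y) - e \<le> measure lebesgue C"
      using Am Cm C(2) by (subst (asm) measurable_measure_Diff) (auto simp: fmeasurableD)
    then show ?thesis
      using \<open>compact C\<close> C(2) IA(4)[OF y] by (intro exI[of _ C]) (auto simp: borel_compact)
  qed
  then obtain C where C: "\<And>y. y \<in> I \<Longrightarrow> compact (C y) \<and> C y \<subseteq> A y \<and> measure lborel (A y) - e \<le> measure lborel (C y)"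
    by metis
  have "e * \<Sum>I \<le> (\<Sum>y\<in>I. y * measure lborel (A y)) - N"
    using N_less I0 by (simp add: e_def field_simps)
  then have "N \<le> (\<Sum>y\<in>I. y * (measure lborel (A y) - e))"
    by (simp add: right_diff_distrib sum_subtractf sum_distrib_left mult.commute)
  also have "\<dots> \<le> (\<Sum>y\<in>I. y * measure lborel (C y))"
    using C IA(3) by (intro sum_mono mult_left_mono) (auto intro: less_imp_le)
  finally have NC: "N \<le> (\<Sum>y\<in>I. y * measure lborel (C y))" .
  have "I \<noteq> {}" using N_less \<open>0 \<le> N\<close> by auto
  have disj: "disjoint_family_on C I" using IA(2) C by (fastforce simp: disjoint_family_on_def)
  have y_eq: "(y powr (1 + rate)) powr ?p = y" if "y \<in> I" for y
    using IA(3)[OF that] rate_pos by (simp add: powr_powr)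
  have "lower (\<lambda>x. \<Sum>y\<in>I. ennreal (y powr (1 + rate)) * indicator (C y) x)
    (quantization_const * (\<Sum>y\<in>I. (y powr (1 + rate)) powr ?p * measure lborel (C y)) powr (1 + rate))"
    using IA(1,3) \<open>I \<noteq> {}\<close> C disj by (intro lower_disjoint_compact) auto
  also have "(\<Sum>y\<in>I. (y powr (1 + rate)) powr ?p * measure lborel (C y)) = (\<Sum>y\<in>I. y * measure lborel (C y))"
    by (intro sum.cong refl) (simp only: y_eq)
  finally show ?thesis
  proof (rule lower_mono)
    show "quantization_const * N powr (1 + rate) \<le> quantization_const * (\<Sum>y\<in>I. y * measure lborel (C y)) powr (1 + rate)"
      using NC \<open>0 \<le> N\<close> quantization_const_pos rate_pos by (intro mult_left_mono powr_mono2) auto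
    show "(\<Sum>y\<in>I. ennreal (y powr (1 + rate)) * indicator (C y) x) \<le> ennreal (f x)" for x
    proof (rule disjoint_sum_indicator_le[OF IA(1) disj], rule ennreal_leI)
      fix y assume y: "y \<in> I" "x \<in> C y"
      then have "y powr (1 + rate) \<le> (f x powr ?p) powr (1 + rate)"
        using IA(3)[of y] IA(6)[of y x] C[of y] rate_pos by (intro powr_mono2) auto
      then show "y powr (1 + rate) \<le> f x"
        using f0[of x] rate_pos by (simp add: powr_powr)
    qed
  qed
qed

text \<open>Here f itself is approximated, in the weighted L1 norm of \<open>upper_moment\<close>:
  the remainder then counts as \<epsilon> in the additive quantity. The simple part contributes at
  most S because its levels lie below f.\<close>

lemma upper_density:
  fixes f :: "'a \<Rightarrow> real"
  assumes [measurable]: "f \<in> borel_measurable borel" and f0: "\<And>x. 0 \<le> f x" and "0 \<le> S"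
    and S: "(\<integral>\<^sup>+x. ennreal (f x powr (1 / (1 + rate))) \<partial>lborel) \<le> ennreal S"
    and "0 < \<delta>" and moment: "(\<integral>\<^sup>+x. ennreal ((1 + norm x) powr (r + \<delta>)) * ennreal (f x) \<partial>lborel) < \<infinity>"
  shows "upper (\<lambda>x. ennreal (f x)) (quantization_const * S powr (1 + rate))"
proof (rule upper_powr_limit)
  fix \<epsilon> :: real assume \<epsilon>: "0 < \<epsilon>"
  let ?p = "1 / (1 + rate)"
  define w where "w = (\<lambda>x::'a. ennreal ((1 + norm x) powr (r + \<delta>)))"
  have [measurable]: "w \<in> borel_measurable borel" unfolding w_def by measurable
  obtain K where K: "0 \<le> K" "\<And>g I. g \<in> borel_measurable borel \<Longrightarrow> 0 \<le> I \<Longrightarrow>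
      (\<integral>\<^sup>+x. w x * g x \<partial>lborel) \<le> ennreal I \<Longrightarrow> upper g (K * I)"
    unfolding w_def using upper_moment[OF \<open>0 < \<delta>\<close>] by blast
  define \<eta> where "\<eta> = quantization_const * \<epsilon> powr (1 + rate) / (K + 1)"
  have \<eta>: "0 < \<eta>" using K \<epsilon> quantization_const_pos by (simp add: \<eta>_def)
  have K\<eta>: "K * \<eta> \<le> quantization_const * \<epsilon> powr (1 + rate)"
  proof -
    have "K * \<eta> \<le> (K + 1) * \<eta>" using \<eta> by simp
    then show ?thesis using K by (simp add: \<eta>_def)
  qed
  define t where "t = (\<integral>\<^sup>+x. w x * ennreal (f x) \<partial>lborel)"
  have t: "t < \<top>" using moment by (simp add: t_def w_def)
  show "upper (\<lambda>x. ennreal (f x)) (quantization_const * (S + \<epsilon>) powr (1 + rate))"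
  \<comment> \<open>If t \<le> \<eta>, the difference t - \<eta> is 0 and need not lie strictly
    below t, as the approximation requires. In that case f as a whole is a remainder.\<close>
  proof (cases "t \<le> ennreal \<eta>")
    case True
    then have "upper (\<lambda>x. ennreal (f x)) (K * \<eta>)"
      using \<eta> by (intro K(2)) (auto simp: t_def)
    moreover have "K * \<eta> \<le> quantization_const * (S + \<epsilon>) powr (1 + rate)"
      using K\<eta> \<open>0 \<le> S\<close> \<epsilon> quantization_const_pos rate_pos
      by (elim order_trans) (intro mult_left_mono powr_mono2, auto)
    ultimately show ?thesis by (auto intro: upper_mono)
  next
    case False
    then have "t - ennreal \<eta> < t"
      using t \<eta> by (intro ennreal_between) (auto simp: not_le intro: order_le_less_trans)
    then obtain I :: "real set" and A where IA: "finite I" "disjoint_family_on A I"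
      "\<And>y. y \<in> I \<Longrightarrow> 0 < y" "\<And>y. y \<in> I \<Longrightarrow> A y \<in> sets borel" "\<And>y. y \<in> I \<Longrightarrow> bounded (A y)"
      "\<And>x y. y \<in> I \<Longrightarrow> x \<in> A y \<Longrightarrow> y \<le> f x"
      and less: "t - ennreal \<eta> < (\<integral>\<^sup>+x. w x * (\<Sum>y\<in>I. ennreal y * indicator (A y) x) \<partial>lborel)"
      unfolding t_def by (rule simple_approximation_from_below[rotated 3]) (use f0 in auto)
    define h where "h = (\<lambda>x. \<Sum>y\<in>I. ennreal y * indicator (A y) x)"
    have [measurable]: "h \<in> borel_measurable borel"
      unfolding h_def using IA(4) by (intro borel_measurable_sum borel_measurable_times) auto
    have hf: "h x \<le> ennreal (f x)" for x
      unfolding h_def using IA by (intro disjoint_sum_indicator_le) (auto intro: ennreal_leI)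
    define g where "g = (\<lambda>x. ennreal (f x) - h x)"
    have [measurable]: "g \<in> borel_measurable borel" unfolding g_def by measurable
    have gh: "ennreal (f x) = h x + g x" for x
      unfolding g_def using hf[of x] by (simp add: add_diff_inverse_ennreal)
    have "t = (\<integral>\<^sup>+x. w x * h x \<partial>lborel) + (\<integral>\<^sup>+x. w x * g x \<partial>lborel)"
      unfolding t_def gh distrib_left by (rule nn_integral_add) measurable
    then have "(\<integral>\<^sup>+x. w x * g x \<partial>lborel) = t - (\<integral>\<^sup>+x. w x * h x \<partial>lborel)"
      using t by (simp add: ennreal_add_diff_cancel_left less_top)
    also have "\<dots> \<le> ennreal \<eta>"
    proof -
      have "t - ennreal \<eta> \<le> (\<integral>\<^sup>+x. w x * h x \<partial>lborel)"
        using less by (simp add: h_def less_imp_le)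
      then show ?thesis
        using t by (auto simp: ennreal_minus_le_iff add.commute)
    qed
    finally have "upper g (K * \<eta>)" using \<eta> by (intro K(2)) auto
    then have g: "upper g (quantization_const * \<epsilon> powr (1 + rate))"
      using K\<eta> by (auto intro: upper_mono)
    define N where "N = (\<lambda>y. y powr ?p * measure lborel (A y))"
    have "upper h (quantization_const * (\<Sum>y\<in>I. N y) powr (1 + rate))"
      unfolding h_def
    proof (rule upper_sum[OF IA(1)])
      fix y assume y: "y \<in> I"
      have "upper (\<lambda>x. ennreal y * indicator (A y) x) (y * (quantization_const * measure lborel (A y) powr (1 + rate)))"
        using IA(3-5)[OF y] by (intro upper_cmult upper_bounded_set) auto
      also have "y * (quantization_const * measure lborel (A y) powr (1 + rate)) = quantization_const * N y powr (1 + rate)"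
        using IA(3)[OF y] rate_pos by (simp add: N_def powr_mult powr_powr)
      finally show "upper (\<lambda>x. ennreal y * indicator (A y) x) (quantization_const * N y powr (1 + rate))" .
      show "(\<lambda>x. ennreal y * indicator (A y) x) \<in> borel_measurable borel" using IA(4)[OF y] by simp
    qed (use quantization_const_pos in \<open>auto simp: N_def\<close>)
    moreover have N0: "0 \<le> (\<Sum>y\<in>I. N y)" by (intro sum_nonneg) (simp add: N_def)
    ultimately have "upper (\<lambda>x. h x + g x) (quantization_const * ((\<Sum>y\<in>I. N y) + \<epsilon>) powr (1 + rate))"
      using g \<epsilon> quantization_const_pos by (intro upper_add) auto
    moreover have "(\<Sum>y\<in>I. N y) \<le> S"
    proof -
      have "ennreal (\<Sum>y\<in>I. N y) = (\<Sum>y\<in>I. ennreal (y powr ?p) * emeasure lborel (A y))"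
      proof (subst sum_ennreal[symmetric])
        show "(\<Sum>y\<in>I. ennreal (N y)) = (\<Sum>y\<in>I. ennreal (y powr ?p) * emeasure lborel (A y))"
          using bounded_borel_fmeasurable[OF IA(5,4)]
          by (intro sum.cong refl) (simp add: N_def ennreal_mult emeasure_eq_measure2)
      qed (simp add: N_def)
      also have "\<dots> = (\<integral>\<^sup>+x. (\<Sum>y\<in>I. ennreal (y powr ?p) * indicator (A y) x) \<partial>lborel)"
        using IA(4) by (simp add: nn_integral_sum nn_integral_cmult_indicator)
      also have "\<dots> \<le> (\<integral>\<^sup>+x. ennreal (f x powr ?p) \<partial>lborel)"
        using IA rate_pos
        by (intro nn_integral_mono disjoint_sum_indicator_le)
          (auto intro!: ennreal_leI powr_mono2 simp: less_imp_le)
      also have "\<dots> \<le> ennreal S" by (rule S)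
      finally show ?thesis using \<open>0 \<le> S\<close> by simp
    qed
    ultimately show ?thesis
      unfolding gh[symmetric]
      using N0 \<epsilon> quantization_const_pos rate_pos
      by (elim upper_mono) (auto intro!: mult_left_mono powr_mono2)
  qed
qed fact

section \<open>From asymptotic bounds to the limit\<close>

lemma lower_imp_eventually:
  assumes "lower g c" "a < ennreal c"
  shows "\<forall>\<^sub>F m in sequentially. a < ennreal (real m powr rate) * qerr m g"
proof -
  obtain b where b: "a < b" "b < ennreal c" using dense[OF assms(2)] by blast
  then obtain b' where b': "b = ennreal b'" "0 \<le> b'" by (cases b) auto
  then have "b' < c" using b(2) by (simp add: ennreal_less_iff)
  with assms(1) have "\<forall>\<^sub>F m in sequentially. ennreal (b' * real m powr - rate) \<le> qerr m g"
    by (simp add: lower_def)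
  then show ?thesis
    using eventually_gt_at_top[of 0]
  proof eventually_elim
    case (elim m)
    have "b = ennreal (real m powr rate) * ennreal (b' * real m powr - rate)"
      using elim(2) b' by (simp add: ennreal_mult[symmetric] powr_minus)
    also have "\<dots> \<le> ennreal (real m powr rate) * qerr m g"
      using elim(1) by (rule mult_left_mono) simp
    finally show ?case using b(1) by simp
  qed
qed

lemma upper_imp_eventually:
  assumes "upper g c" "0 \<le> c" "ennreal c < a"
  shows "\<forall>\<^sub>F m in sequentially. ennreal (real m powr rate) * qerr m g < a"
proof -
  obtain b where b: "ennreal c < b" "b < a" using dense[OF assms(3)] by blast
  then obtain b' where b': "b = ennreal b'" "0 \<le> b'" by (cases b) (auto simp: top_unique less_top[symmetric])
  then have "c < b'" using b(1) assms(2) by (simp add: ennreal_less_iff)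
  with assms(1) have "\<forall>\<^sub>F m in sequentially. qerr m g \<le> ennreal (b' * real m powr - rate)"
    by (simp add: upper_def)
  then show ?thesis
    using eventually_gt_at_top[of 0]
  proof eventually_elim
    case (elim m)
    have "ennreal (real m powr rate) * qerr m g \<le> ennreal (real m powr rate) * ennreal (b' * real m powr - rate)"
      using elim(1) by (rule mult_left_mono) simp
    also have "\<dots> = b"
      using elim(2) b' by (simp add: ennreal_mult[symmetric] powr_minus)
    finally show ?case using b(2) by simp
  qed
qed

text \<open>If the integral is infinite, \<open>lower_density\<close> applies with arbitrarily large
  N and forces the limit \<top>. Accordingly the moment is demanded only for a finite
  integral.\<close>

theorem zador:
  fixes f :: "'a \<Rightarrow> real"
  assumes f: "f \<in> borel_measurable borel" "\<And>x. 0 \<le> f x"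
    and moment: "(\<integral>\<^sup>+x. ennreal (f x powr (1 / (1 + rate))) \<partial>lborel) < \<infinity> \<Longrightarrow>
      \<exists>\<delta>>0. (\<integral>\<^sup>+x. ennreal ((1 + norm x) powr (r + \<delta>)) * ennreal (f x) \<partial>lborel) < \<infinity>"
  shows "(\<lambda>m. ennreal (real m powr rate) * qerr m (\<lambda>x. ennreal (f x)))
    \<longlonglongrightarrow> ennreal quantization_const * ennreal_powr (\<integral>\<^sup>+x. ennreal (f x powr (1 / (1 + rate))) \<partial>lborel) (1 + rate)"
proof (cases "\<integral>\<^sup>+x. ennreal (f x powr (1 / (1 + rate))) \<partial>lborel")
  case (real S)
  let ?c = "quantization_const * S powr (1 + rate)"
  have eq: "ennreal quantization_const * ennreal_powr (\<integral>\<^sup>+x. ennreal (f x powr (1 / (1 + rate))) \<partial>lborel) (1 + rate) = ennreal ?c"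
    using real quantization_const_pos by (simp add: ennreal_powr_def ennreal_mult)
  have "lower (\<lambda>x. ennreal (f x)) ?c"
  proof (rule lower_limit)
    fix c assume c: "c < ?c"
    show "lower (\<lambda>x. ennreal (f x)) c"
    proof (cases "c < 0")
      case True
      then show ?thesis by (auto simp: lower_def ennreal_neg mult_nonpos_nonneg)
    next
      case False
      define N where "N = (c / quantization_const) powr (1 / (1 + rate))"
      have N: "0 \<le> N" "quantization_const * N powr (1 + rate) = c"
        using False quantization_const_pos rate_pos by (auto simp: N_def powr_powr)
      have "N < S"
      proof (rule ccontr)
        assume "\<not> N < S"
        then have "?c \<le> quantization_const * N powr (1 + rate)"
          using real quantization_const_pos rate_pos by (intro mult_left_mono powr_mono2) auto
        with N c show False by simp
      qed
      then have "lower (\<lambda>x. ennreal (f x)) (quantization_const * N powr (1 + rate))"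
        using f N real by (intro lower_density) (auto simp: ennreal_less_iff)
      then show ?thesis using N by simp
    qed
  qed
  moreover obtain \<delta> where "0 < \<delta>" "(\<integral>\<^sup>+x. ennreal ((1 + norm x) powr (r + \<delta>)) * ennreal (f x) \<partial>lborel) < \<infinity>"
    using moment real by auto
  then have "upper (\<lambda>x. ennreal (f x)) ?c"
    using f real by (intro upper_density) auto
  ultimately show ?thesis
    unfolding eq using quantization_const_pos
    by (intro order_tendstoI) (auto intro: lower_imp_eventually upper_imp_eventually)
next
  case top
  have eq: "ennreal quantization_const * ennreal_powr (\<integral>\<^sup>+x. ennreal (f x powr (1 / (1 + rate))) \<partial>lborel) (1 + rate) = \<top>"
    using top quantization_const_pos by (simp add: ennreal_powr_def ennreal_mult_top)
  show ?thesis
    unfolding eq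
  proof (rule order_tendstoI)
    fix a :: ennreal assume "a < \<top>"
    then obtain a' where a': "a = ennreal a'" "0 \<le> a'" by (cases a) auto
    define N where "N = ((a' + 1) / quantization_const) powr (1 / (1 + rate))"
    have N: "0 \<le> N" "quantization_const * N powr (1 + rate) = a' + 1"
      using a' quantization_const_pos rate_pos by (auto simp: N_def powr_powr)
    then have "lower (\<lambda>x. ennreal (f x)) (a' + 1)"
      using f top lower_density[of f N] by auto
    then show "\<forall>\<^sub>F m in sequentially. a < ennreal (real m powr rate) * qerr m (\<lambda>x. ennreal (f x))"
      using a' by (intro lower_imp_eventually) (auto simp: ennreal_less_iff)
  qed simp
qed

end

subsection \<open>Transport through finitely many points\<close>

lemma cost_via_ge:
  fixes x y :: "'a::real_normed_vector"
  assumes "finite Z" "Z \<noteq> {}" "0 \<le> \<sigma>"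
  shows "2 powr (\<sigma> - 1) * (infdist x Z powr \<sigma> + infdist y Z powr \<sigma>) \<le> cost_via \<sigma> Z x y"
  unfolding cost_via_def
proof (intro Min.boundedI; (elim imageE)?)
  fix a z assume a: "a = cost1 \<sigma> x z + cost2 \<sigma> z y" and z: "z \<in> Z"
  have "infdist x Z powr \<sigma> \<le> norm (x - z) powr \<sigma>" "infdist y Z powr \<sigma> \<le> norm (z - y) powr \<sigma>"
    using infdist_le[OF z, of x] infdist_le[OF z, of y] assms
    by (auto intro!: powr_mono2 infdist_nonneg simp: dist_norm norm_minus_commute)
  then show "2 powr (\<sigma> - 1) * (infdist x Z powr \<sigma> + infdist y Z powr \<sigma>) \<le> a"
    unfolding a cost1_def cost2_def distrib_left[symmetric] by (intro mult_left_mono add_mono) auto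
qed (use assms in auto)

lemma cost_via_diagonal_le:
  fixes x :: "'a::euclidean_space"
  assumes "finite Z" "Z \<noteq> {}"
  shows "cost_via \<sigma> Z x x \<le> 2 powr \<sigma> * infdist x Z powr \<sigma>"
proof -
  obtain z where z: "z \<in> Z" "infdist x Z = dist x z"
    using infdist_attains_inf[of Z x] assms by (auto simp: finite_imp_closed)
  have "cost_via \<sigma> Z x x \<le> cost1 \<sigma> x z + cost2 \<sigma> z x"
    unfolding cost_via_def using assms z by (intro Min_le) auto
  also have "\<dots> = 2 powr \<sigma> * infdist x Z powr \<sigma>"
    unfolding z(2) by (simp add: cost1_def cost2_def dist_norm norm_minus_commute powr_diff)
  finally show ?thesis .
qed

context
  fixes \<mu> :: "'a::euclidean_space measure"
  assumes prob: "prob_space \<mu>" and sets_\<mu>: "sets \<mu> = sets borel"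
begin

interpretation prob_space \<mu> by (rule prob)

lemma diagonal_measurable: "(\<lambda>x. (x, x)) \<in> \<mu> \<rightarrow>\<^sub>M (borel :: ('a \<times> 'a) measure)"
  unfolding measurable_cong_sets[OF sets_\<mu> refl]
  by (intro borel_measurable_continuous_onI continuous_intros)

lemma diagonal_coupling: "distr \<mu> borel (\<lambda>x. (x, x)) \<in> couplings \<mu> \<mu>"
proof -
  have "fst \<in> (borel :: ('a \<times> 'a) measure) \<rightarrow>\<^sub>M borel" "snd \<in> (borel :: ('a \<times> 'a) measure) \<rightarrow>\<^sub>M borel"
    by (intro borel_measurable_continuous_onI continuous_intros)+
  then have "distr (distr \<mu> borel (\<lambda>x. (x, x))) borel fst = \<mu>" "distr (distr \<mu> borel (\<lambda>x. (x, x))) borel snd = \<mu>"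
    using diagonal_measurable distr_id2[OF sets_\<mu>[symmetric]]
    by (simp_all add: distr_distr comp_def id_def)
  then show ?thesis
    using diagonal_measurable by (simp add: couplings_def prob_space_distr)
qed

lemma transport_cost_le_diagonal:
  assumes "(\<lambda>p. c (fst p) (snd p)) \<in> borel_measurable borel"
  shows "transport_cost c \<mu> \<mu> \<le> (\<integral>\<^sup>+x. ennreal (c x x) \<partial>\<mu>)"
proof -
  have "transport_cost c \<mu> \<mu> \<le> (\<integral>\<^sup>+p. ennreal (c (fst p) (snd p)) \<partial>distr \<mu> borel (\<lambda>x. (x, x)))"
    unfolding transport_cost_def by (rule INF_lower[OF diagonal_coupling])
  also have "\<dots> = (\<integral>\<^sup>+x. ennreal (c x x) \<partial>\<mu>)"
    using assms by (subst nn_integral_distr[OF diagonal_measurable]) auto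
  finally show ?thesis .
qed

lemma transport_cost_cost_self: "transport_cost (cost \<sigma>) \<mu> \<mu> = 0"
proof -
  have "(\<lambda>p. cost \<sigma> (fst p) (snd p)) \<in> borel_measurable (borel :: ('a \<times> 'a) measure)"
    unfolding cost_def
    by (intro powr_real_measurable borel_measurable_const borel_measurable_continuous_onI continuous_intros)
  from transport_cost_le_diagonal[OF this]
  have "transport_cost (cost \<sigma>) \<mu> \<mu> \<le> (\<integral>\<^sup>+x. ennreal (cost \<sigma> x x) \<partial>\<mu>)" .
  moreover have "cost \<sigma> x x = 0" for x :: 'a by (simp add: cost_def)
  ultimately show ?thesis by simp
qed

text \<open>The lower bound of \<open>cost_via_ge\<close> is a function of x plus a function of y,
  so its integral depends only on the marginals and is the same for all couplings. The diagonal
  coupling attains it.\<close>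

lemma transport_cost_cost_via_self:
  assumes Z: "finite Z" "Z \<noteq> {}" and "0 \<le> \<sigma>"
  shows "transport_cost (cost_via \<sigma> Z) \<mu> \<mu> = ennreal (2 powr \<sigma>) * (\<integral>\<^sup>+x. ennreal (infdist x Z powr \<sigma>) \<partial>\<mu>)"
proof (rule antisym)
  let ?d = "\<lambda>x. infdist x Z powr \<sigma>"
  have meas: "(\<lambda>x. ennreal (?d x)) \<in> borel_measurable borel" by measurable
  then have meas_\<mu>: "(\<lambda>x. ennreal (?d x)) \<in> borel_measurable \<mu>"
    by (simp add: measurable_cong_sets[OF sets_\<mu> refl])
  have "(\<lambda>p. cost_via \<sigma> Z (fst p) (snd p)) \<in> borel_measurable (borel :: ('a \<times> 'a) measure)"
    unfolding cost_via_def cost1_def cost2_def using Z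
    by (intro borel_measurable_Min borel_measurable_add borel_measurable_times powr_real_measurable
        borel_measurable_const borel_measurable_continuous_onI continuous_intros)
  then have "transport_cost (cost_via \<sigma> Z) \<mu> \<mu> \<le> (\<integral>\<^sup>+x. ennreal (cost_via \<sigma> Z x x) \<partial>\<mu>)"
    by (rule transport_cost_le_diagonal)
  also have "\<dots> \<le> (\<integral>\<^sup>+x. ennreal (2 powr \<sigma>) * ennreal (?d x) \<partial>\<mu>)"
    using cost_via_diagonal_le[OF Z]
    by (intro nn_integral_mono) (auto simp: ennreal_mult[symmetric] intro: ennreal_leI)
  also have "\<dots> = ennreal (2 powr \<sigma>) * (\<integral>\<^sup>+x. ennreal (?d x) \<partial>\<mu>)"
    by (rule nn_integral_cmult[OF meas_\<mu>])
  finally show "transport_cost (cost_via \<sigma> Z) \<mu> \<mu> \<le> ennreal (2 powr \<sigma>) * (\<integral>\<^sup>+x. ennreal (?d x) \<partial>\<mu>)" .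
  show "ennreal (2 powr \<sigma>) * (\<integral>\<^sup>+x. ennreal (?d x) \<partial>\<mu>) \<le> transport_cost (cost_via \<sigma> Z) \<mu> \<mu>"
    unfolding transport_cost_def
  proof (rule INF_greatest)
    fix \<pi> assume "\<pi> \<in> couplings \<mu> \<mu>"
    then have \<pi>: "sets \<pi> = sets borel" "distr \<pi> borel fst = \<mu>" "distr \<pi> borel snd = \<mu>"
      by (auto simp: couplings_def)
    have [measurable]: "fst \<in> \<pi> \<rightarrow>\<^sub>M borel" "snd \<in> \<pi> \<rightarrow>\<^sub>M borel"
      unfolding measurable_cong_sets[OF \<pi>(1) refl]
      by (intro borel_measurable_continuous_onI continuous_intros)+
    have fst: "(\<integral>\<^sup>+p. ennreal (?d (fst p)) \<partial>\<pi>) = (\<integral>\<^sup>+x. ennreal (?d x) \<partial>\<mu>)"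
    proof -
      have "(\<integral>\<^sup>+x. ennreal (?d x) \<partial>distr \<pi> borel fst) = (\<integral>\<^sup>+p. ennreal (?d (fst p)) \<partial>\<pi>)"
        by (rule nn_integral_distr) (use meas in auto)
      then show ?thesis by (simp only: \<pi>(2))
    qed
    have snd: "(\<integral>\<^sup>+p. ennreal (?d (snd p)) \<partial>\<pi>) = (\<integral>\<^sup>+x. ennreal (?d x) \<partial>\<mu>)"
    proof -
      have "(\<integral>\<^sup>+x. ennreal (?d x) \<partial>distr \<pi> borel snd) = (\<integral>\<^sup>+p. ennreal (?d (snd p)) \<partial>\<pi>)"
        by (rule nn_integral_distr) (use meas in auto)
      then show ?thesis by (simp only: \<pi>(3))
    qed
    have "ennreal (2 powr \<sigma>) = ennreal (2 powr (\<sigma> - 1)) + ennreal (2 powr (\<sigma> - 1))"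
      by (subst ennreal_plus[symmetric]) (auto simp: powr_diff)
    then have "ennreal (2 powr \<sigma>) * (\<integral>\<^sup>+x. ennreal (?d x) \<partial>\<mu>)
        = ennreal (2 powr (\<sigma> - 1)) * ((\<integral>\<^sup>+p. ennreal (?d (fst p)) \<partial>\<pi>) + (\<integral>\<^sup>+p. ennreal (?d (snd p)) \<partial>\<pi>))"
      unfolding fst snd by (simp only: distrib_left distrib_right)
    also have "\<dots> = (\<integral>\<^sup>+p. ennreal (2 powr (\<sigma> - 1)) * (ennreal (?d (fst p)) + ennreal (?d (snd p))) \<partial>\<pi>)"
      by (subst nn_integral_cmult) (auto simp: nn_integral_add)
    also have "\<dots> \<le> (\<integral>\<^sup>+p. ennreal (cost_via \<sigma> Z (fst p) (snd p)) \<partial>\<pi>)"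
      using cost_via_ge[OF Z \<open>0 \<le> \<sigma>\<close>]
      by (intro nn_integral_mono) (auto simp: ennreal_mult[symmetric] ennreal_plus[symmetric] simp del: ennreal_plus intro!: ennreal_leI)
    finally show "ennreal (2 powr \<sigma>) * (\<integral>\<^sup>+x. ennreal (?d x) \<partial>\<mu>) \<le> (\<integral>\<^sup>+p. ennreal (cost_via \<sigma> Z (fst p) (snd p)) \<partial>\<pi>)" .
  qed
qed

end

text \<open>\<open>phi\<close> asks for exactly m points and \<open>qerr\<close> for at most m. As
  the space is infinite, a smaller set can be filled up with arbitrary points, which does not
  increase the distortion. For m = 0 the cost would be a \<open>Min\<close> over the empty
  set.\<close>

lemma phi_eq_qerr:
  fixes f :: "'a::euclidean_space \<Rightarrow> real"
  assumes [measurable]: "f \<in> borel_measurable borel" and prob: "prob_space (density lborel (\<lambda>x. ennreal (f x)))"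
    and "0 < \<sigma>" "0 < m"
  shows "phi \<sigma> m (density lborel (\<lambda>x. ennreal (f x))) (density lborel (\<lambda>x. ennreal (f x)))
    = ennreal (2 powr \<sigma>) * quantization.qerr \<sigma> m (\<lambda>x. ennreal (f x))"
proof -
  interpret quantization \<sigma> "TYPE('a)" by standard fact
  let ?\<mu> = "density lborel (\<lambda>x. ennreal (f x))"
  let ?F = "\<lambda>x. ennreal (f x)"
  have sets: "sets ?\<mu> = sets borel" by simp
  have cost: "transport_cost (cost_via \<sigma> Z) ?\<mu> ?\<mu> = distortion Z (\<lambda>x. ennreal (2 powr \<sigma>) * ?F x)"
    if "finite Z" "Z \<noteq> {}" for Z
  proof -
    have "(\<integral>\<^sup>+x. ennreal (infdist x Z powr \<sigma>) \<partial>?\<mu>) = distortion Z ?F"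
      unfolding distortion_def by (subst nn_integral_density) (auto simp: mult.commute)
    then show ?thesis
      using transport_cost_cost_via_self[OF prob sets that] \<open>0 < \<sigma>\<close> by (simp add: distortion_cmult)
  qed
  have "(INF Z\<in>{Z. finite Z \<and> card Z = m}. transport_cost (cost_via \<sigma> Z) ?\<mu> ?\<mu>) = qerr m (\<lambda>x. ennreal (2 powr \<sigma>) * ?F x)"
  proof (rule antisym)
    show "(INF Z\<in>{Z. finite Z \<and> card Z = m}. transport_cost (cost_via \<sigma> Z) ?\<mu> ?\<mu>) \<le> qerr m (\<lambda>x. ennreal (2 powr \<sigma>) * ?F x)"
    proof (rule qerr_greatest)
      fix Z :: "'a set" assume Z: "finite Z" "Z \<noteq> {}" "card Z \<le> m"
      have "infinite (UNIV :: 'a set)" using finite_imp_bounded not_bounded_UNIV by blast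
      then obtain B where B: "finite B" "card B = m - card Z" "Z \<inter> B = {}"
        using finite_arbitrarily_large_disj[OF _ Z(1)] by blast
      have "card (Z \<union> B) = m" using B Z by (simp add: card_Un_disjoint)
      then have "(INF Z\<in>{Z. finite Z \<and> card Z = m}. transport_cost (cost_via \<sigma> Z) ?\<mu> ?\<mu>) \<le> transport_cost (cost_via \<sigma> (Z \<union> B)) ?\<mu> ?\<mu>"
        using B Z by (intro INF_lower) auto
      also have "\<dots> = distortion (Z \<union> B) (\<lambda>x. ennreal (2 powr \<sigma>) * ?F x)"
        using B Z by (intro cost) auto
      also have "\<dots> \<le> distortion Z (\<lambda>x. ennreal (2 powr \<sigma>) * ?F x)"
        using Z by (intro distortion_mono) auto
      finally show "(INF Z\<in>{Z. finite Z \<and> card Z = m}. transport_cost (cost_via \<sigma> Z) ?\<mu> ?\<mu>) \<le> distortion Z (\<lambda>x. ennreal (2 powr \<sigma>) * ?F x)" .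
    qed
    show "qerr m (\<lambda>x. ennreal (2 powr \<sigma>) * ?F x) \<le> (INF Z\<in>{Z. finite Z \<and> card Z = m}. transport_cost (cost_via \<sigma> Z) ?\<mu> ?\<mu>)"
    proof (rule INF_greatest)
      fix Z :: "'a set" assume "Z \<in> {Z. finite Z \<and> card Z = m}"
      with \<open>0 < m\<close> have Z: "finite Z" "Z \<noteq> {}" "card Z \<le> m" by auto
      show "qerr m (\<lambda>x. ennreal (2 powr \<sigma>) * ?F x) \<le> transport_cost (cost_via \<sigma> Z) ?\<mu> ?\<mu>"
        unfolding cost[OF Z(1,2)] by (rule qerr_le[OF Z])
    qed
  qed
  also have "\<dots> = ennreal (2 powr \<sigma>) * qerr m ?F" by (rule qerr_cmult) auto
  finally show ?thesis
    by (simp add: phi_def transport_cost_cost_self[OF prob sets])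
qed

text \<open>With q = \<sigma> + \<delta>, (1 + t)^q is at most 2^q (1 + t^q); the summand 1 is
  integrated against total mass 1.\<close>

lemma finite_higher_moment_one_plus:
  fixes f :: "'a::euclidean_space \<Rightarrow> real"
  assumes [measurable]: "f \<in> borel_measurable borel" and f0: "\<And>x. 0 \<le> f x"
    and prob: "prob_space (density lborel (\<lambda>x. ennreal (f x)))" and "0 < \<sigma>" and moment: "finite_higher_moment \<sigma> f"
  shows "\<exists>\<delta>>0. (\<integral>\<^sup>+x. ennreal ((1 + norm x) powr (\<sigma> + \<delta>)) * ennreal (f x) \<partial>lborel) < \<infinity>"
proof -
  obtain \<delta> where \<delta>: "0 < \<delta>" "(\<integral>\<^sup>+x. ennreal (norm x powr (\<sigma> + \<delta>) * f x) \<partial>lborel) < \<infinity>"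
    using moment by (auto simp: finite_higher_moment_def)
  let ?q = "\<sigma> + \<delta>"
  have mass: "(\<integral>\<^sup>+x. ennreal (f x) \<partial>lborel) = 1"
    using prob_space.emeasure_space_1[OF prob] by (simp add: emeasure_density)
  have le: "(1 + t) powr ?q \<le> 2 powr ?q * (1 + t powr ?q)" if "0 \<le> t" for t :: real
  proof -
    have "(1 + t) powr ?q \<le> (2 * max 1 t) powr ?q"
      using that \<delta>(1) \<open>0 < \<sigma>\<close> by (intro powr_mono2) auto
    also have "\<dots> = 2 powr ?q * max 1 t powr ?q" using that by (simp add: powr_mult)
    also have "\<dots> \<le> 2 powr ?q * (1 + t powr ?q)"
      by (intro mult_left_mono) (auto simp: max_def)
    finally show ?thesis .
  qed
  have "(\<integral>\<^sup>+x. ennreal ((1 + norm x) powr ?q) * ennreal (f x) \<partial>lborel)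
      \<le> (\<integral>\<^sup>+x. ennreal (2 powr ?q) * (ennreal (f x) + ennreal (norm x powr ?q * f x)) \<partial>lborel)"
  proof (rule nn_integral_mono)
    fix x :: 'a
    have "(1 + norm x) powr ?q * f x \<le> 2 powr ?q * (f x + norm x powr ?q * f x)"
      using mult_right_mono[OF le[of "norm x"] f0[of x]] by (simp add: algebra_simps)
    then show "ennreal ((1 + norm x) powr ?q) * ennreal (f x) \<le> ennreal (2 powr ?q) * (ennreal (f x) + ennreal (norm x powr ?q * f x))"
      using f0[of x]
      by (subst ennreal_plus[symmetric]) (auto simp: ennreal_mult[symmetric] simp del: ennreal_plus intro: ennreal_leI)
  qed
  also have "\<dots> = ennreal (2 powr ?q) * (1 + (\<integral>\<^sup>+x. ennreal (norm x powr ?q * f x) \<partial>lborel))"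
    by (simp add: nn_integral_cmult nn_integral_add mass)
  also have "\<dots> < \<infinity>" using \<delta>(2) by (simp add: ennreal_mult_less_top)
  finally show ?thesis using \<delta>(1) by blast
qed

theorem proposition5p2:
  fixes \<sigma> :: real
  assumes "\<sigma> \<ge> 1"
  shows "\<exists>C::real. C \<ge> 0 \<and>
    (\<forall>f :: real ^ 'd \<Rightarrow> real.
       f \<in> borel_measurable borel \<and> (\<forall>x. f x \<ge> 0) \<and>
       prob_space (density lborel (\<lambda>x. ennreal (f x))) \<and>
       ((\<integral>\<^sup>+ x. ennreal (f x powr (real CARD('d) / (real CARD('d) + \<sigma>))) \<partial>lborel) < \<infinity>
          \<longrightarrow> finite_higher_moment \<sigma> f) \<longrightarrow>
       (\<lambda>m. ennreal (real m powr (\<sigma> / real CARD('d))) *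
            phi \<sigma> m (density lborel (\<lambda>x. ennreal (f x))) (density lborel (\<lambda>x. ennreal (f x))))
         \<longlonglongrightarrow> ennreal C *
             ennreal_powr (\<integral>\<^sup>+ x. ennreal (f x powr (real CARD('d) / (real CARD('d) + \<sigma>))) \<partial>lborel)
               ((real CARD('d) + \<sigma>) / real CARD('d)))"
proof -
  have "0 < \<sigma>" using assms by simp
  interpret quantization \<sigma> "TYPE(real ^ 'd)" by standard fact
  have rate: "\<sigma> / real CARD('d) = rate" "real CARD('d) / (real CARD('d) + \<sigma>) = 1 / (1 + rate)"
    "(real CARD('d) + \<sigma>) / real CARD('d) = 1 + rate"
    using \<open>0 < \<sigma>\<close> by (auto simp: rate_def field_simps)
  show ?thesis
    unfolding rate
  \<comment> \<open>The factor 2^\<sigma> is twice 2^(\<sigma>-1), one for each leg of the path from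
    x via z to x. The witness is chosen before f.\<close>
  proof (intro exI[of _ "2 powr \<sigma> * quantization_const"] conjI allI impI; (elim conjE)?)
    show "0 \<le> 2 powr \<sigma> * quantization_const" using quantization_const_pos by simp
    fix f :: "real ^ 'd \<Rightarrow> real"
    assume f: "f \<in> borel_measurable borel" "\<forall>x. 0 \<le> f x" "prob_space (density lborel (\<lambda>x. ennreal (f x)))"
      and moment: "(\<integral>\<^sup>+x. ennreal (f x powr (1 / (1 + rate))) \<partial>lborel) < \<infinity> \<longrightarrow> finite_higher_moment \<sigma> f"
    let ?F = "\<lambda>x. ennreal (f x)"
    let ?J = "ennreal_powr (\<integral>\<^sup>+x. ennreal (f x powr (1 / (1 + rate))) \<partial>lborel) (1 + rate)"
    have "(\<lambda>m. ennreal (real m powr rate) * qerr m ?F) \<longlonglongrightarrow> ennreal quantization_const * ?J"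
      using f moment finite_higher_moment_one_plus[OF f(1) _ f(3) \<open>0 < \<sigma>\<close>] by (intro zador) auto
    then have "(\<lambda>m. ennreal (2 powr \<sigma>) * (ennreal (real m powr rate) * qerr m ?F)) \<longlonglongrightarrow> ennreal (2 powr \<sigma>) * (ennreal quantization_const * ?J)"
      by (intro ennreal_tendsto_cmult) auto
    then have lim: "(\<lambda>m. ennreal (2 powr \<sigma>) * (ennreal (real m powr rate) * qerr m ?F)) \<longlonglongrightarrow> ennreal (2 powr \<sigma> * quantization_const) * ?J"
      using quantization_const_pos by (simp add: ennreal_mult mult.assoc)
    show "(\<lambda>m. ennreal (real m powr rate) * phi \<sigma> m (density lborel ?F) (density lborel ?F)) \<longlonglongrightarrow> ennreal (2 powr \<sigma> * quantization_const) * ?J"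
    proof (rule Lim_transform_eventually[OF lim])
      show "\<forall>\<^sub>F m in sequentially. ennreal (2 powr \<sigma>) * (ennreal (real m powr rate) * qerr m ?F)
        = ennreal (real m powr rate) * phi \<sigma> m (density lborel ?F) (density lborel ?F)"
        using eventually_gt_at_top[of 0]
        by eventually_elim (use f \<open>0 < \<sigma>\<close> in \<open>simp add: phi_eq_qerr mult.left_commute\<close>)
    qed
  qed
qed

end
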